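(* There exist binary linear codes with the following parameters: (i) an $[818,792,3]_2 3,2$ code (length $818$, codimension $26$, minimum distance $3$, covering radius $3$) whose parity-check matrix admits a $(3,0)$-partition and a $(3,1)$-partition each into at most $35$ subsets, and a $(3,2)$-partition; in particular $\ell_2(26,3)\le818$; (ii) a $[13118,13080,3]_2 3,1$ code (codimension $38$) whose parity-check matrix admits a $(3,0)$-partition into at most $57$ subsets and a $(3,1)$-partition into at most $59$ subsets; in particular $\ell_2(38,3)\le13118$; (iii) a $[26238,26197,3]_2 3,1$ code (codimension $41$) whose parity-check matrix admits a $(3,0)$-partition into at most $89$ subsets and a $(3,1)$-partition into at most $91$ subsets; in particular $\ell_2(41,3)\le 26238$.
   Context: For an $r\times n$ binary parity-check matrix $H$ and $0\le\ell\le R$, an $(R,\ell)$-partition is a partition of the columns of $H$ into nonempty subsets such that every vector of $\mathbb{F}_2^r$ (including zero) is the sum of at least $\ell$ and at most $R$ columns lying in pairwise distinct subsets (zero = empty sum when $\ell=0$). An $[n,n-r,d]_2R,\ell$ code is a binary linear code of length $n$, codimension $r$, minimum distance $d$, covering radius $R$ (smallest $R$ such that every vector of $\mathbb{F}_2^r$ is a sum of at most $R$ columns of a parity-check matrix), having a parity-check matrix that admits an $(R,\ell)$-partition. $\ell_2(r,R)$ is the smallest length of a binary linear code of codimension $r$ and covering radius $R$. *)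

theory Defs
  imports "HOL-Library.Z2" "HOL-Library.Disjoint_Sets"
begin

text \<open>Binary matrices/vectors: a vector of F_2^r is a function nat => bit vanishing at
  indices >= r; an r x n matrix H has entry H i j (row i, column j), vanishing outside
  the range. Codewords (binary vectors of length n) are identified with their supports.\<close>

definition is_vec :: "nat \<Rightarrow> (nat \<Rightarrow> bit) \<Rightarrow> bool" where
  "is_vec r v \<longleftrightarrow> (\<forall>i\<ge>r. v i = 0)"

definition is_matrix :: "nat \<Rightarrow> nat \<Rightarrow> (nat \<Rightarrow> nat \<Rightarrow> bit) \<Rightarrow> bool" where
  "is_matrix r n H \<longleftrightarrow> (\<forall>i j. (r \<le> i \<or> n \<le> j) \<longrightarrow> H i j = 0)"

definition colsum :: "(nat \<Rightarrow> nat \<Rightarrow> bit) \<Rightarrow> nat set \<Rightarrow> nat \<Rightarrow> bit" where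
  "colsum H S = (\<lambda>i. \<Sum>j\<in>S. H i j)"

definition min_dist :: "(nat \<Rightarrow> nat \<Rightarrow> bit) \<Rightarrow> nat \<Rightarrow> nat \<Rightarrow> bool" where
  "min_dist H n d \<longleftrightarrow>
     (\<exists>x. x \<noteq> {} \<and> x \<subseteq> {0..<n} \<and> colsum H x = (\<lambda>_. 0) \<and> card x = d) \<and>
     (\<forall>x. x \<noteq> {} \<and> x \<subseteq> {0..<n} \<and> colsum H x = (\<lambda>_. 0) \<longrightarrow> d \<le> card x)"

definition covered_within :: "(nat \<Rightarrow> nat \<Rightarrow> bit) \<Rightarrow> nat \<Rightarrow> nat \<Rightarrow> nat \<Rightarrow> bool" where
  "covered_within H r n R \<longleftrightarrow>
     (\<forall>v. is_vec r v \<longrightarrow> (\<exists>S. S \<subseteq> {0..<n} \<and> card S \<le> R \<and> colsum H S = v))"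

definition covering_radius :: "(nat \<Rightarrow> nat \<Rightarrow> bit) \<Rightarrow> nat \<Rightarrow> nat \<Rightarrow> nat \<Rightarrow> bool" where
  "covering_radius H r n R \<longleftrightarrow> covered_within H r n R \<and> (\<forall>R'<R. \<not> covered_within H r n R')"

definition RL_partition :: "(nat \<Rightarrow> nat \<Rightarrow> bit) \<Rightarrow> nat \<Rightarrow> nat \<Rightarrow> nat \<Rightarrow> nat \<Rightarrow> nat set set \<Rightarrow> bool" where
  "RL_partition H r n R l P \<longleftrightarrow> partition_on {0..<n} P \<and>
     (\<forall>v. is_vec r v \<longrightarrow> (\<exists>S. S \<subseteq> {0..<n} \<and> l \<le> card S \<and> card S \<le> R \<and> colsum H S = v \<and>
                                 (\<forall>A\<in>P. card (S \<inter> A) \<le> 1)))"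

definition code_params :: "(nat \<Rightarrow> nat \<Rightarrow> bit) \<Rightarrow> nat \<Rightarrow> nat \<Rightarrow> nat \<Rightarrow> nat \<Rightarrow> nat \<Rightarrow> bool" where
  "code_params H n r d R l \<longleftrightarrow> is_matrix r n H \<and> min_dist H n d \<and> covering_radius H r n R \<and>
     (\<exists>P. RL_partition H r n R l P)"

definition ell2 :: "nat \<Rightarrow> nat \<Rightarrow> nat" where
  "ell2 r R = (LEAST n. \<exists>H. is_matrix r n H \<and> covering_radius H r n R)"

end

theory Submission
  imports Defs "HOL-Computational_Algebra.Polynomial" "HOL-Library.Code_Binary_Nat"
begin

text \<open>
  Each code is a concatenation over the binary Golay code. Let h_1, ..., h_23 be the columns of a
  parity-check matrix of the perfect [23,12,7]3 Golay code, b_1, ..., b_23 elements of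
  F_2[X]/(f), deg f = m, such that all b_j and all b_i - b_j are units, and C a set of columns in
  F_2^{2m} with covering radius 2. The columns of the new matrix are (h_j; x; b_j x; b_j^2 x) for all
  x, together with (0; 0; 0; y) for y nonzero and, for c in C, the column with c in the two middle
  blocks and zeros elsewhere. A vector whose first block is a sum of three h_j is covered by solving
  a Vandermonde system; if it is a sum of two h_j, the last block is corrected by one column
  (0; 0; 0; y), if it is a single h_j, the two middle blocks by at most two columns of C, and if it
  is 0, both kinds of correction are used. The length is 23 * 2^m + (2^m - 1) + |C|, and
  23 + 1 subsets plus those of C suffice.

  For m = 5 the set C is a [51,41]2 code with a partition into 11 subsets, found by a computer
  search. For m = 9 and m = 10 it is obtained from that code by the analogous concatenation for
  radius 2, with columns (c; x; b_c x) and (0; 0; y), of lengths 51 * 16 + 15 = 831 and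
  51 * 32 + 31 = 1663. Here the elements b_c are constant on the subsets of a partition of the
  51 columns and exhaust the field, so that (0; a; b) is covered by two columns with the same c.
\<close>

section \<open>Binary vectors as polynomials\<close>

lemma bit_poly_add_self [simp]: "p + p = (0 :: bit poly)"
proof (rule poly_eqI)
  fix n show "coeff (p + p) n = coeff 0 n"
    unfolding coeff_add by (cases "coeff p n") auto
qed

lemma bit_poly_two [simp]: "(2 :: bit poly) = 0"
  unfolding one_add_one[symmetric] by (rule bit_poly_add_self)

lemma bit_poly_uminus [simp]: "- p = (p :: bit poly)"
  by (rule poly_eqI) simp

lemma bit_poly_add_left_cancel [simp]: "p + (p + q) = (q :: bit poly)"
  by (simp only: bit_poly_add_self add_0 flip: add.assoc)

lemma bit_poly_diff: "p - q = p + (q :: bit poly)"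
  using diff_conv_add_uminus[of p q] by simp

lemma bit_poly_add_eq_0_iff: "p + q = 0 \<longleftrightarrow> p = (q :: bit poly)"
  using add_eq_0_iff[of p q] by auto

text \<open>Vectors of F_2^r are taken as polynomials, so that blocks of a column and residues
  modulo a polynomial of degree \<open>r\<close> are objects of the same kind.\<close>

definition vecs :: "nat \<Rightarrow> bit poly set" where
  "vecs r = {p. is_vec r (coeff p)}"

lemma vecs_0: "vecs 0 = {0}"
  by (auto simp: vecs_def is_vec_def poly_eq_iff)

lemma vecs_Suc: "p \<in> vecs (Suc r) \<longleftrightarrow> (\<exists>b q. q \<in> vecs r \<and> p = pCons b q)"
proof
  assume "p \<in> vecs (Suc r)"
  then show "\<exists>b q. q \<in> vecs r \<and> p = pCons b q"
    by (cases p) (fastforce simp: vecs_def is_vec_def coeff_pCons split: nat.splits)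
qed (auto simp: vecs_def is_vec_def coeff_pCons split: nat.splits)

lemma vecs_zero [simp]: "0 \<in> vecs r"
  by (simp add: vecs_def is_vec_def)

lemma vecs_add [intro]: "p \<in> vecs r \<Longrightarrow> q \<in> vecs r \<Longrightarrow> p + q \<in> vecs r"
  by (simp add: vecs_def is_vec_def)

lemma finite_card_vecs: "finite (vecs r) \<and> card (vecs r) = 2 ^ r"
proof (induction r)
  case 0
  then show ?case by (simp add: vecs_0)
next
  case (Suc r)
  have U: "(UNIV :: bit set) = {0, 1}"
    using bit_not_one_iff by auto
  have "vecs (Suc r) = (\<lambda>(b, q). pCons b q) ` (UNIV \<times> vecs r)"
    by (force simp: vecs_Suc)
  moreover have "inj_on (\<lambda>(b, q). pCons b q) (UNIV \<times> vecs r)"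
    by (auto simp: inj_on_def)
  ultimately show ?case
    using Suc by (simp add: card_image card_cartesian_product U)
qed

lemmas finite_vecs [simp] = finite_card_vecs[THEN conjunct1]
lemmas card_vecs = finite_card_vecs[THEN conjunct2]

lemma vecs_degree: "0 < r \<Longrightarrow> p \<in> vecs r \<longleftrightarrow> degree p < r"
  by (auto simp: vecs_def is_vec_def intro: coeff_eq_0 degree_lessI)

text \<open>Concatenation of vectors: for \<open>h\<close> of length \<open>r\<close>, the
  coefficients of \<open>w\<close> follow those of \<open>h\<close>, starting at index
  \<open>r\<close>.\<close>

definition app :: "nat \<Rightarrow> bit poly \<Rightarrow> bit poly \<Rightarrow> bit poly" where
  "app r h w = h + monom 1 r * w"

lemma app_add: "app r h w + app r h' w' = app r (h + h') (w + w')"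
  by (simp add: app_def algebra_simps)

lemma app_zero [simp]: "app r 0 0 = 0"
  by (simp add: app_def)

lemma coeff_app: "h \<in> vecs r \<Longrightarrow> coeff (app r h w) i = (if i < r then coeff h i else coeff w (i - r))"
  by (auto simp: app_def coeff_monom_mult vecs_def is_vec_def)

lemma app_in_vecs [intro]: "h \<in> vecs r \<Longrightarrow> w \<in> vecs k \<Longrightarrow> app r h w \<in> vecs (r + k)"
  unfolding vecs_def[of "r + k"] is_vec_def by (auto simp: coeff_app) (auto simp: vecs_def is_vec_def)

lemma app_eq_iff:
  assumes "h \<in> vecs r" "h' \<in> vecs r"
  shows "app r h w = app r h' w' \<longleftrightarrow> h = h' \<and> w = w'"
proof
  assume eq: "app r h w = app r h' w'"
  have "coeff h i = coeff h' i" for i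
  proof (cases "i < r")
    case True
    then show ?thesis using arg_cong[OF eq, of "\<lambda>p. coeff p i"] by (simp add: coeff_app assms)
  qed (use assms in \<open>auto simp: vecs_def is_vec_def\<close>)
  moreover have "coeff w i = coeff w' i" for i
    using arg_cong[OF eq, of "\<lambda>p. coeff p (r + i)"] by (simp add: coeff_app assms)
  ultimately show "h = h' \<and> w = w'" by (auto simp: poly_eq_iff)
qed simp

lemma app_eq_0_iff: "h \<in> vecs r \<Longrightarrow> app r h w = 0 \<longleftrightarrow> h = 0 \<and> w = 0"
  using app_eq_iff[of h r 0 w 0] by simp

lemma vecs_appE:
  assumes "v \<in> vecs (r + k)"
  obtains h w where "h \<in> vecs r" "w \<in> vecs k" "v = app r h w"
proof -
  have "\<exists>h w. h \<in> vecs r \<and> w \<in> vecs k \<and> v = app r h w"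
    using assms
  proof (induction r arbitrary: v)
    case 0
    then show ?case by (auto simp: vecs_0 app_def)
  next
    case (Suc r)
    then obtain b q where v: "v = pCons b q" "q \<in> vecs (r + k)" by (auto simp: vecs_Suc)
    with Suc.IH obtain h w where "h \<in> vecs r" "w \<in> vecs k" "q = app r h w" by blast
    with v show ?case
      by (intro exI[of _ "pCons b h"] exI[of _ w]) (auto simp: vecs_Suc app_def monom_Suc)
  qed
  with that show thesis by blast
qed

section \<open>Units and Vandermonde systems modulo a polynomial\<close>

definition unit_mod :: "bit poly \<Rightarrow> bit poly \<Rightarrow> bool" where
  "unit_mod f g \<longleftrightarrow> (\<exists>u. f dvd g * u + 1)"

lemma mod_eq_iff_dvd_add:
  "degree f = m \<Longrightarrow> 0 < m \<Longrightarrow> b \<in> vecs m \<Longrightarrow> p mod f = b \<longleftrightarrow> f dvd p + b"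
  using mod_eq_dvd_iff[of p f b] by (simp add: bit_poly_diff mod_poly_less vecs_degree)

lemma mod_in_vecs: "degree f = m \<Longrightarrow> 0 < m \<Longrightarrow> p mod f \<in> vecs m"
  using degree_mod_less'[of f p] by (cases "p mod f = 0"; cases "f = 0") (simp_all add: vecs_degree)

lemma dvd_add_mod: "(f :: bit poly) dvd p + p mod f"
  using dvd_minus_mod[of f p] by (simp add: bit_poly_diff)

text \<open>Over F_2 the condition \<open>f dvd g * u + 1\<close> says that \<open>u\<close> inverts
  \<open>g\<close> modulo \<open>f\<close>, so \<open>u * b\<close> reduced modulo \<open>f\<close>
  is a solution.\<close>

lemma unit_mod_solve:
  assumes "degree f = m" "0 < m" "unit_mod f g" "b \<in> vecs m"
  shows "\<exists>x\<in>vecs m. (g * x) mod f = b"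
proof -
  from assms obtain u where u: "f dvd g * u + 1" by (auto simp: unit_mod_def)
  define x where "x = (u * b) mod f"
  have "g * x + b = g * (u * b + x) + (g * u + 1) * b"
    by (simp add: algebra_simps)
  then have "f dvd g * x + b"
    using u dvd_add_mod[of f "u * b"] by (simp add: x_def)
  then show ?thesis
    using assms by (auto simp: mod_eq_iff_dvd_add x_def mod_in_vecs)
qed

text \<open>Substituting \<open>x = a + y\<close> in the 2 by 2 Vandermonde system leaves
  \<open>(p + q) * y = b + p * a\<close> modulo \<open>f\<close>.\<close>

lemma solve2:
  assumes f: "degree f = m" "0 < m" and "unit_mod f (p + q)" and ab: "a \<in> vecs m" "b \<in> vecs m"
  shows "\<exists>x\<in>vecs m. \<exists>y\<in>vecs m. x + y = a \<and> (p * x + q * y) mod f = b"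
proof -
  obtain y where y: "y \<in> vecs m" "((p + q) * y) mod f = (b + p * a) mod f"
    using unit_mod_solve[OF assms(1-3), of "(b + p * a) mod f"] f by (auto simp: mod_in_vecs)
  have "(p * (a + y) + q * y) mod f = (p * a + (p + q) * y) mod f"
    by (simp add: algebra_simps)
  also have "\<dots> = (p * a) mod f + (b + p * a) mod f"
    by (simp add: poly_mod_add_left y)
  also have "\<dots> = (p * a + (b + p * a)) mod f"
    by (simp add: poly_mod_add_left)
  also have "p * a + (b + p * a) = b" by (simp add: ac_simps)
  also have "b mod f = b" using f ab by (simp add: mod_poly_less vecs_degree)
  finally show ?thesis
    using ab y by (intro bexI[of _ "a + y"] bexI[of _ y]) (auto simp: ac_simps)
qed

text \<open>Eliminating \<open>x = a + y + z\<close> leaves a Vandermonde system with nodes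
  \<open>q\<close>, \<open>t\<close> for \<open>y' = (p + q) * y\<close> and
  \<open>z' = (p + t) * z\<close>. \<open>solve2\<close> yields \<open>y'\<close> and
  \<open>z'\<close>; dividing by the two units recovers \<open>y\<close> and
  \<open>z\<close>.\<close>

lemma solve3:
  assumes f: "degree f = m" "0 < m"
    and u: "unit_mod f (p + q)" "unit_mod f (p + t)" "unit_mod f (q + t)"
    and abc: "a \<in> vecs m" "b \<in> vecs m" "c \<in> vecs m"
  shows "\<exists>x\<in>vecs m. \<exists>y\<in>vecs m. \<exists>z\<in>vecs m. x + y + z = a \<and> (p * x + q * y + t * z) mod f = b \<and>
           (p * p * x + q * q * y + t * t * z) mod f = c"
proof -
  note [simp] = mod_in_vecs[OF f]
  obtain y' z' where yz': "y' \<in> vecs m" "z' \<in> vecs m" "y' + z' = (b + p * a) mod f"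
    "(q * y' + t * z') mod f = (c + p * b) mod f"
    using solve2[OF f u(3), of "(b + p * a) mod f" "(c + p * b) mod f"] by auto
  obtain y z where yz: "y \<in> vecs m" "((p + q) * y) mod f = y'" "z \<in> vecs m" "((p + t) * z) mod f = z'"
    using unit_mod_solve[OF f u(1) yz'(1)] unit_mod_solve[OF f u(2) yz'(2)] by blast
  define x where "x = a + y + z"
  have b: "b mod f = b" "c mod f = c" using f abc by (simp_all add: mod_poly_less vecs_degree)
  have "(p * x + q * y + t * z) mod f = (p * a + ((p + q) * y + (p + t) * z)) mod f"
    by (simp add: x_def algebra_simps)
  also have "\<dots> = (p * a) mod f + (y' + z')" by (simp add: poly_mod_add_left yz)
  also have "\<dots> = (p * a + (b + p * a)) mod f" unfolding yz' by (simp add: poly_mod_add_left)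
  also have "\<dots> = b" using b by (simp add: ac_simps)
  finally have 1: "(p * x + q * y + t * z) mod f = b" .
  have "(p * p * x + q * q * y + t * t * z) mod f
      = (p * (p * x + q * y + t * z) + (q * ((p + q) * y) + t * ((p + t) * z))) mod f"
    by (simp add: algebra_simps)
  also have "\<dots> = (p * (p * x + q * y + t * z)) mod f +
      ((q * ((p + q) * y)) mod f + (t * ((p + t) * z)) mod f)"
    by (simp add: poly_mod_add_left)
  also have "(p * (p * x + q * y + t * z)) mod f = (p * b) mod f"
    by (metis 1 mod_mult_right_eq)
  also have "(q * ((p + q) * y)) mod f = (q * y') mod f"
    by (metis yz(2) mod_mult_right_eq)
  also have "(t * ((p + t) * z)) mod f = (t * z') mod f"
    by (metis yz(4) mod_mult_right_eq)
  also have "(q * y') mod f + (t * z') mod f = (c + p * b) mod f"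
    using yz'(4) by (simp add: poly_mod_add_left)
  also have "(p * b) mod f + (c + p * b) mod f = c"
    using b by (simp add: poly_mod_add_left ac_simps)
  finally have "(p * p * x + q * q * y + t * t * z) mod f = c" .
  moreover have "x \<in> vecs m" "x + y + z = a" using abc yz by (auto simp: x_def ac_simps)
  ultimately show ?thesis using 1 yz by blast
qed

section \<open>Concatenation\<close>

text \<open>
  A family of columns is a function \<open>s\<close> on an index set \<open>I\<close>; the partition is given by the fibres of
  a colouring \<open>\<kappa>\<close> of the indices.
\<close>

definition cover :: "nat \<Rightarrow> nat \<Rightarrow> 'i set \<Rightarrow> ('i \<Rightarrow> bit poly) \<Rightarrow> ('i \<Rightarrow> 'c) \<Rightarrow> bit poly \<Rightarrow> bool" where
  "cover l R I s \<kappa> v \<longleftrightarrow> (\<exists>xs. set xs \<subseteq> I \<and> l \<le> length xs \<and> length xs \<le> R \<and>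
     distinct (map \<kappa> xs) \<and> (\<Sum>x\<leftarrow>xs. s x) = v)"

text \<open>Distinct nonzero columns are what later excludes codewords of weight 1 and 2.\<close>

definition column_system :: "nat \<Rightarrow> nat \<Rightarrow> 'i set \<Rightarrow> ('i \<Rightarrow> bit poly) \<Rightarrow> ('i \<Rightarrow> 'c) \<Rightarrow> bool" where
  "column_system R r I s \<kappa> \<longleftrightarrow> finite I \<and> inj_on s I \<and> s ` I \<subseteq> vecs r - {0} \<and>
     (\<forall>v\<in>vecs r. cover 0 R I s \<kappa> v)"

lemma coverI:
  "set xs \<subseteq> I \<Longrightarrow> l \<le> length xs \<Longrightarrow> length xs \<le> R \<Longrightarrow> distinct (map \<kappa> xs) \<Longrightarrow>
   (\<Sum>x\<leftarrow>xs. s x) = v \<Longrightarrow> cover l R I s \<kappa> v"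
  unfolding cover_def by blast

text \<open>Indices with distinct \<kappa>-colours keep distinct colours under the finer \<mu>, so
  the same list works.\<close>

lemma cover_refine:
  assumes "cover l R I s \<kappa> v" "\<And>i j. i \<in> I \<Longrightarrow> j \<in> I \<Longrightarrow> \<mu> i = \<mu> j \<Longrightarrow> \<kappa> i = \<kappa> j"
  shows "cover l R I s \<mu> v"
proof -
  from assms obtain xs where xs: "set xs \<subseteq> I" "l \<le> length xs" "length xs \<le> R"
    "distinct (map \<kappa> xs)" "(\<Sum>x\<leftarrow>xs. s x) = v" by (auto simp: cover_def)
  have "inj_on \<mu> (set xs)"
    using xs(1,4) assms(2) by (auto simp: distinct_map inj_on_def subset_iff)
  with xs show ?thesis by (intro coverI[of xs]) (auto simp: distinct_map)
qed

lemma column_system_refine: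
  assumes "column_system R r I s \<kappa>" "\<And>i j. i \<in> I \<Longrightarrow> j \<in> I \<Longrightarrow> \<mu> i = \<mu> j \<Longrightarrow> \<kappa> i = \<kappa> j"
  shows "column_system R r I s \<mu>"
proof -
  have "cover 0 R I s \<mu> v" if "v \<in> vecs r" for v
  proof -
    from assms(1) that have "cover 0 R I s \<kappa> v" by (simp add: column_system_def)
    then show ?thesis using assms(2) by (rule cover_refine)
  qed
  with assms(1) show ?thesis by (simp add: column_system_def)
qed

lemma column_system_cong:
  assumes "column_system R r I s \<kappa>" "\<And>i. i \<in> I \<Longrightarrow> s i = s' i" "\<And>i. i \<in> I \<Longrightarrow> \<kappa> i = \<kappa>' i"
  shows "column_system R r I s' \<kappa>'"
proof -
  have "inj_on s' I = inj_on s I" "s' ` I = s ` I"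
    using assms(2) by (auto cong: inj_on_cong image_cong)
  moreover have "cover 0 R I s' \<kappa>' v" if "cover 0 R I s \<kappa> v" for v
  proof -
    from that obtain xs where xs: "set xs \<subseteq> I" "length xs \<le> R" "distinct (map \<kappa> xs)"
      "(\<Sum>x\<leftarrow>xs. s x) = v" by (auto simp: cover_def)
    moreover have "map s xs = map s' xs" "map \<kappa> xs = map \<kappa>' xs"
      using assms(2,3) xs(1) by auto
    ultimately show ?thesis by (intro coverI[of xs]) simp_all
  qed
  ultimately show ?thesis using assms(1) by (simp add: column_system_def)
qed

lemma sum_list_app: "(\<Sum>x\<leftarrow>xs. app r (h x) (w x)) = app r (\<Sum>x\<leftarrow>xs. h x) (\<Sum>x\<leftarrow>xs. w x)"
  by (induction xs) (auto simp: app_add)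

lemma list_cases_le3:
  assumes "length xs \<le> 3"
  obtains "xs = []" | x where "xs = [x]" | x y where "xs = [x, y]" | x y z where "xs = [x, y, z]"
  using assms by (auto simp: numeral_3_eq_3 length_Suc_conv le_Suc_eq)

text \<open>A correction by \<open>c\<close> takes one column, or none if \<open>c = 0\<close>: the
  index sets below have no column for the value 0.\<close>

definition nonzero :: "(bit poly \<Rightarrow> 'a) \<Rightarrow> bit poly \<Rightarrow> 'a list" where
  "nonzero k c = (if c = 0 then [] else [k c])"

locale concatenation =
  fixes f :: "bit poly" and m r :: nat
  assumes deg: "degree f = m" "0 < m"
begin

lemma mod_vecs [simp]: "p mod f \<in> vecs m"
  by (rule mod_in_vecs[OF deg])

section \<open>The concatenation for radius 2\<close>

definition lift2_index :: "'i set \<Rightarrow> ('i \<times> bit poly + bit poly) set" where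
  "lift2_index I = I \<times> vecs m <+> (vecs m - {0})"

text \<open>The second argument gives the multiplier of each index. In \<open>lift2_system\<close>
  it is the colouring itself, so different colours mean different multipliers.\<close>

fun lift2_column :: "('i \<Rightarrow> bit poly) \<Rightarrow> ('i \<Rightarrow> bit poly) \<Rightarrow> 'i \<times> bit poly + bit poly \<Rightarrow> bit poly" where
  "lift2_column s \<kappa> (Inl (i, x)) = app r (s i) (app m x ((\<kappa> i * x) mod f))"
| "lift2_column s \<kappa> (Inr y) = app r 0 (app m 0 y)"

text \<open>
  Separating \<open>x = 0\<close> from \<open>x \<noteq> 0\<close> allows two columns with the same \<open>i\<close> to be added: this is how
  vectors with zero top part are reached.
\<close>

fun lift2_colour :: "('i \<Rightarrow> 'c) \<Rightarrow> 'i \<times> bit poly + bit poly \<Rightarrow> 'c \<times> bool + unit" where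
  "lift2_colour \<kappa> (Inl (i, x)) = Inl (\<kappa> i, x = 0)"
| "lift2_colour \<kappa> (Inr y) = Inr ()"

lemma card_lift2:
  assumes "finite I"
  shows "card (lift2_index I) = card I * 2 ^ m + (2 ^ m - 1)"
    and "card (lift2_colour \<kappa> ` lift2_index I) \<le> 2 * card (\<kappa> ` I) + 1"
proof -
  show "card (lift2_index I) = card I * 2 ^ m + (2 ^ m - 1)"
    using assms by (simp add: lift2_index_def card_Plus card_cartesian_product card_vecs)
  have "lift2_colour \<kappa> ` lift2_index I \<subseteq> \<kappa> ` I \<times> UNIV <+> UNIV"
    by (auto simp: lift2_index_def)
  then have "card (lift2_colour \<kappa> ` lift2_index I) \<le> card (\<kappa> ` I \<times> (UNIV :: bool set) <+> (UNIV :: unit set))"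
    using assms by (intro card_mono) auto
  also have "\<dots> = 2 * card (\<kappa> ` I) + 1"
    using assms by (simp add: card_Plus card_cartesian_product)
  finally show "card (lift2_colour \<kappa> ` lift2_index I) \<le> 2 * card (\<kappa> ` I) + 1" .
qed

text \<open>Multipliers of different colours differ by a unit, so two top columns reduce to
  \<open>solve2\<close>. A single top column takes \<open>x = a\<close>, and one column
  \<open>Inr y\<close> repairs the last block.\<close>

lemma lift2_system:
  assumes I: "column_system 2 r I s \<kappa>" and \<kappa>: "\<kappa> ` I = vecs m"
    and unit: "\<And>g. g \<in> vecs m \<Longrightarrow> g \<noteq> 0 \<Longrightarrow> unit_mod f g"
  shows "column_system 2 (r + 2 * m) (lift2_index I) (lift2_column s \<kappa>) (lift2_colour \<kappa>)"
proof -
  have s: "finite I" "inj_on s I" "\<And>i. i \<in> I \<Longrightarrow> s i \<in> vecs r" "\<And>i. i \<in> I \<Longrightarrow> s i \<noteq> 0"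
    and cov: "\<And>v. v \<in> vecs r \<Longrightarrow> cover 0 2 I s \<kappa> v"
    using I by (auto simp: column_system_def)
  note [simp] = lift2_index_def app_add app_eq_iff app_eq_0_iff s
  have app_vecs: "app r h (app m a b) \<in> vecs (r + 2 * m)"
    if "h \<in> vecs r" "a \<in> vecs m" "b \<in> vecs m" for h a b
    using that by (auto simp: mult_2)
  have "cover 0 2 (lift2_index I) (lift2_column s \<kappa>) (lift2_colour \<kappa>) v"
    if v: "v \<in> vecs (r + 2 * m)" for v
  proof -
    from v obtain H a b where H: "H \<in> vecs r" and ab: "a \<in> vecs m" "b \<in> vecs m"
      and v_def: "v = app r H (app m a b)"
      by (metis mult_2 vecs_appE)
    from cov[OF H] obtain xs where xs: "set xs \<subseteq> I" "length xs \<le> 2" "distinct (map \<kappa> xs)"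
      "(\<Sum>x\<leftarrow>xs. s x) = H" by (auto simp: cover_def)
    from xs(2) have "length xs \<le> 3" by simp
    then show ?thesis
    proof (cases rule: list_cases_le3)
      case 1
      show ?thesis
      proof (cases "a = 0")
        case True
        show ?thesis
          by (rule coverI[of "nonzero Inr b"]) (use 1 True xs ab in \<open>auto simp: v_def nonzero_def\<close>)
      next
        case False
        \<comment> \<open>The multipliers exhaust the residues, so some \<open>i\<close> has
          multiplier \<open>b\<close> divided by \<open>a\<close>. In the sum of the columns
          \<open>(i, 0)\<close> and \<open>(i, a)\<close> the top parts cancel.\<close>
        with unit_mod_solve[OF deg unit[OF ab(1)] ab(2)] \<kappa> obtain i where
          i: "i \<in> I" "(a * \<kappa> i) mod f = b" by (metis imageE)
        show ?thesis
          by (rule coverI[of "[Inl (i, 0), Inl (i, a)]"])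
            (use 1 False xs ab i in \<open>auto simp: v_def mult.commute\<close>)
      qed
    next
      case (2 i)
      define y where "y = b + (\<kappa> i * a) mod f"
      have "y \<in> vecs m" using ab by (auto simp: y_def)
      then show ?thesis
        by (intro coverI[of "Inl (i, a) # nonzero Inr y"])
          (use 2 xs ab in \<open>auto simp: v_def y_def nonzero_def bit_poly_add_eq_0_iff ac_simps\<close>)
    next
      case (3 i j)
      then have ij: "i \<in> I" "j \<in> I" "\<kappa> i \<noteq> \<kappa> j" using xs by auto
      then have "unit_mod f (\<kappa> i + \<kappa> j)"
        using \<kappa> by (intro unit) (auto simp: bit_poly_add_eq_0_iff)
      from solve2[OF deg this ab] obtain x y where
        "x \<in> vecs m" "y \<in> vecs m" "x + y = a" "(\<kappa> i * x + \<kappa> j * y) mod f = b" by blast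
      then show ?thesis
        by (intro coverI[of "[Inl (i, x), Inl (j, y)]"])
          (use 3 xs ij in \<open>auto simp: v_def poly_mod_add_left\<close>)
    next
      case (4 i j k)
      with xs show ?thesis by simp
    qed
  qed
  moreover have "inj_on (lift2_column s \<kappa>) (lift2_index I)"
    by (auto simp: inj_on_def dest: inj_onD[OF s(2)])
  moreover have "lift2_column s \<kappa> ` lift2_index I \<subseteq> vecs (r + 2 * m) - {0}"
    by (auto simp: app_vecs)
  ultimately show ?thesis by (simp add: column_system_def)
qed

text \<open>The columns with \<open>x = 0\<close> are the old columns padded with zeros, so a zero
  sum of three columns survives.\<close>

lemma lift2_triangle:
  assumes "cover 3 3 I s \<kappa> 0"
  shows "cover 3 3 (lift2_index I) (lift2_column s \<kappa>) (lift2_colour \<kappa>) 0"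
proof -
  from assms obtain xs where xs: "set xs \<subseteq> I" "length xs = 3" "distinct (map \<kappa> xs)"
    "(\<Sum>x\<leftarrow>xs. s x) = 0" by (auto simp: cover_def)
  have "(\<Sum>x\<leftarrow>map (\<lambda>i. Inl (i, 0)) xs. lift2_column s \<kappa> x) = app r (\<Sum>x\<leftarrow>xs. s x) (\<Sum>x\<leftarrow>xs. 0)"
    by (simp add: comp_def sum_list_app)
  with xs show ?thesis
    by (intro coverI[of "map (\<lambda>i. Inl (i, 0)) xs"])
      (auto simp: lift2_index_def comp_def distinct_map inj_on_def)
qed

section \<open>The concatenation for radius 3\<close>

definition lift3_index :: "'j set \<Rightarrow> 'i set \<Rightarrow> ('j \<times> bit poly + bit poly + 'i) set" where
  "lift3_index J I = J \<times> vecs m <+> (vecs m - {0}) <+> I"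

text \<open>The blocks have lengths \<open>r\<close>, \<open>2 * m\<close> and \<open>m\<close>; the
  two middle blocks are kept together as the space of the radius-2 family.\<close>

definition join :: "bit poly \<Rightarrow> bit poly \<Rightarrow> bit poly \<Rightarrow> bit poly" where
  "join h w c = app r h (app (2 * m) w c)"

fun lift3_column :: "('j \<Rightarrow> bit poly) \<Rightarrow> ('j \<Rightarrow> bit poly) \<Rightarrow> ('i \<Rightarrow> bit poly) \<Rightarrow>
    'j \<times> bit poly + bit poly + 'i \<Rightarrow> bit poly" where
  "lift3_column h \<beta> s (Inl (j, x)) = join (h j) (app m x ((\<beta> j * x) mod f)) ((\<beta> j * \<beta> j * x) mod f)"
| "lift3_column h \<beta> s (Inr (Inl y)) = join 0 0 y"
| "lift3_column h \<beta> s (Inr (Inr i)) = join 0 (s i) 0"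

text \<open>Here \<open>x = 0\<close> needs no class of its own: no covering below uses two columns
  with the same \<open>j\<close>.\<close>

fun lift3_colour :: "('i \<Rightarrow> 'c) \<Rightarrow> 'j \<times> bit poly + bit poly + 'i \<Rightarrow> 'j + unit + 'c" where
  "lift3_colour \<kappa> (Inl (j, x)) = Inl j"
| "lift3_colour \<kappa> (Inr (Inl y)) = Inr (Inl ())"
| "lift3_colour \<kappa> (Inr (Inr i)) = Inr (Inr (\<kappa> i))"

lemma card_lift3:
  assumes "finite I" "finite J"
  shows "card (lift3_index J I) = card J * 2 ^ m + (2 ^ m - 1) + card I"
    and "card (lift3_colour \<kappa> ` lift3_index J I) \<le> card J + 1 + card (\<kappa> ` I)"
proof -
  \<comment> \<open>Writing \<open>2 ^ m\<close> as a successor disposes of the truncated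
    subtraction in \<open>2 ^ m - 1\<close>.\<close>
  obtain n where "(2 :: nat) ^ m = Suc n"
    by (metis gr0_implies_Suc zero_less_power zero_less_numeral)
  then show "card (lift3_index J I) = card J * 2 ^ m + (2 ^ m - 1) + card I"
    using assms by (simp add: lift3_index_def card_Plus card_cartesian_product card_vecs)
  have "lift3_colour \<kappa> ` lift3_index J I \<subseteq> J <+> UNIV <+> \<kappa> ` I"
    by (auto simp: lift3_index_def)
  then have "card (lift3_colour \<kappa> ` lift3_index J I) \<le> card (J <+> (UNIV :: unit set) <+> \<kappa> ` I)"
    using assms by (intro card_mono) auto
  also have "\<dots> = card J + 1 + card (\<kappa> ` I)"
    using assms by (simp add: card_Plus)
  finally show "card (lift3_colour \<kappa> ` lift3_index J I) \<le> card J + 1 + card (\<kappa> ` I)" .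
qed

lemma join_add: "join h w c + join h' w' c' = join (h + h') (w + w') (c + c')"
  by (simp add: join_def app_add)

lemma join_zero [simp]: "join 0 0 0 = 0"
  by (simp add: join_def)

lemma join_eq_iff:
  "h \<in> vecs r \<Longrightarrow> h' \<in> vecs r \<Longrightarrow> w \<in> vecs (2 * m) \<Longrightarrow> w' \<in> vecs (2 * m) \<Longrightarrow>
   join h w c = join h' w' c' \<longleftrightarrow> h = h' \<and> w = w' \<and> c = c'"
  by (simp add: join_def app_eq_iff)

lemma join_eq_0_iff:
  "h \<in> vecs r \<Longrightarrow> w \<in> vecs (2 * m) \<Longrightarrow> join h w c = 0 \<longleftrightarrow> h = 0 \<and> w = 0 \<and> c = 0"
  using join_eq_iff[of h 0 w 0 c 0] by simp

lemma join_in_vecs: "h \<in> vecs r \<Longrightarrow> w \<in> vecs (2 * m) \<Longrightarrow> c \<in> vecs m \<Longrightarrow> join h w c \<in> vecs (r + 3 * m)"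
  using app_in_vecs[of h r "app (2 * m) w c" "2 * m + m"] app_in_vecs[of w "2 * m" c m]
  by (simp add: join_def)

lemma app_m_in_vecs: "a \<in> vecs m \<Longrightarrow> b \<in> vecs m \<Longrightarrow> app m a b \<in> vecs (2 * m)"
  by (auto simp: mult_2)

lemma sum_list_join: "(\<Sum>x\<leftarrow>xs. join 0 (s x) 0) = join 0 (\<Sum>x\<leftarrow>xs. s x) 0"
  by (induction xs) (auto simp: join_add)

text \<open>Units \<beta> i + \<beta> j serve the tops that take two or three columns. Units \<beta>
  j serve the tops that take one, where a single \<open>x\<close> must produce the whole last
  block.\<close>

lemma lift3_system:
  assumes J: "column_system 3 r J h id"
    and unit: "\<And>j. j \<in> J \<Longrightarrow> unit_mod f (\<beta> j)"
      "\<And>i j. i \<in> J \<Longrightarrow> j \<in> J \<Longrightarrow> i \<noteq> j \<Longrightarrow> unit_mod f (\<beta> i + \<beta> j)"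
    and I: "column_system 2 (2 * m) I s \<kappa>"
  shows "column_system 3 (r + 3 * m) (lift3_index J I) (lift3_column h \<beta> s) (lift3_colour \<kappa>)"
proof -
  have h: "finite J" "inj_on h J" "\<And>j. j \<in> J \<Longrightarrow> h j \<in> vecs r" "\<And>j. j \<in> J \<Longrightarrow> h j \<noteq> 0"
    and covJ: "\<And>v. v \<in> vecs r \<Longrightarrow> cover 0 3 J h id v"
    using J by (auto simp: column_system_def)
  have s: "finite I" "inj_on s I" "\<And>i. i \<in> I \<Longrightarrow> s i \<in> vecs (2 * m)" "\<And>i. i \<in> I \<Longrightarrow> s i \<noteq> 0"
    and covI: "\<And>v. v \<in> vecs (2 * m) \<Longrightarrow> cover 0 2 I s \<kappa> v"
    using I by (auto simp: column_system_def)
  note [simp] = lift3_index_def join_add app_add app_eq_iff app_eq_0_iff join_eq_iff join_eq_0_iff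
    app_m_in_vecs h s
  have "cover 0 3 (lift3_index J I) (lift3_column h \<beta> s) (lift3_colour \<kappa>) v"
    if v: "v \<in> vecs (r + 3 * m)" for v
  proof -
    have m3: "r + 3 * m = r + (2 * m + m)" "2 * m = m + m" by simp_all
    from v obtain H a b c where H: "H \<in> vecs r" and abc: "a \<in> vecs m" "b \<in> vecs m" "c \<in> vecs m"
      and v_def: "v = join H (app m a b) c"
      unfolding join_def m3 by (metis vecs_appE)
    from covJ[OF H] obtain js where js: "set js \<subseteq> J" "length js \<le> 3" "distinct js"
      "(\<Sum>x\<leftarrow>js. h x) = H" by (auto simp: cover_def)
    from js(2) show ?thesis
    proof (cases rule: list_cases_le3)
      case 1
      have "app m a b \<in> vecs (2 * m)" using abc by simp
      from covI[OF this] obtain xs where xs: "set xs \<subseteq> I" "length xs \<le> 2" "distinct (map \<kappa> xs)"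
        "(\<Sum>x\<leftarrow>xs. s x) = app m a b" by (auto simp: cover_def)
      show ?thesis
        by (rule coverI[of "nonzero (\<lambda>y. Inr (Inl y)) c @ map (\<lambda>i. Inr (Inr i)) xs"])
          (use 1 js xs abc in \<open>auto simp: v_def comp_def sum_list_join distinct_map inj_on_def nonzero_def\<close>)
    next
      case (2 j)
      then have j: "j \<in> J" using js by auto
      \<comment> \<open>The equation with the square of \<beta> j is solved by dividing twice by
        \<beta> j.\<close>
      obtain u where u: "u \<in> vecs m" "(\<beta> j * u) mod f = c"
        using unit_mod_solve[OF deg unit(1)[OF j] abc(3)] by blast
      obtain x where x: "x \<in> vecs m" "(\<beta> j * x) mod f = u"
        using unit_mod_solve[OF deg unit(1)[OF j] u(1)] by blast
      have c: "(\<beta> j * \<beta> j * x) mod f = c"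
        by (metis u(2) x(2) mod_mult_right_eq mult.assoc)
      \<comment> \<open>The contribution of the chosen column to the middle blocks; the radius-2
        family has to supply \<open>w + app m a b\<close>.\<close>
      define w where "w = app m x ((\<beta> j * x) mod f)"
      have w: "w \<in> vecs (2 * m)" using x u by (simp add: w_def)
      then have "w + app m a b \<in> vecs (2 * m)" using abc by auto
      from covI[OF this] obtain xs where xs: "set xs \<subseteq> I" "length xs \<le> 2" "distinct (map \<kappa> xs)"
        "(\<Sum>x\<leftarrow>xs. s x) = w + app m a b" by (auto simp: cover_def)
      show ?thesis
        by (rule coverI[of "Inl (j, x) # map (\<lambda>i. Inr (Inr i)) xs"])
          (use 2 js xs x j c in \<open>auto simp: v_def comp_def sum_list_join distinct_map inj_on_def
             simp del: app_add simp flip: w_def\<close>)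
    next
      case (3 i j)
      then have ij: "i \<in> J" "j \<in> J" "i \<noteq> j" using js by auto
      from solve2[OF deg unit(2)[OF this] abc(1,2)] obtain x y where xy:
        "x \<in> vecs m" "y \<in> vecs m" "x + y = a" "(\<beta> i * x + \<beta> j * y) mod f = b" by blast
      \<comment> \<open>The error that the two columns leave in the last block.\<close>
      define z where "z = c + (\<beta> i * \<beta> i * x) mod f + (\<beta> j * \<beta> j * y) mod f"
      have "z \<in> vecs m" using abc by (simp add: z_def vecs_add)
      moreover have "(\<beta> i * \<beta> i * x) mod f + ((\<beta> j * \<beta> j * y) mod f + z) = c"
        by (simp add: z_def ac_simps)
      ultimately show ?thesis
        by (intro coverI[of "[Inl (i, x), Inl (j, y)] @ nonzero (\<lambda>y. Inr (Inl y)) z"])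
          (use 3 js ij xy in \<open>auto simp: v_def poly_mod_add_left nonzero_def\<close>)
    next
      case (4 i j k)
      then have ijk: "i \<in> J" "j \<in> J" "k \<in> J" "i \<noteq> j" "i \<noteq> k" "j \<noteq> k" using js by auto
      from solve3[OF deg unit(2)[OF ijk(1,2,4)] unit(2)[OF ijk(1,3,5)] unit(2)[OF ijk(2,3,6)] abc]
      obtain x y z where "x \<in> vecs m" "y \<in> vecs m" "z \<in> vecs m" "x + y + z = a"
        "(\<beta> i * x + \<beta> j * y + \<beta> k * z) mod f = b"
        "(\<beta> i * \<beta> i * x + \<beta> j * \<beta> j * y + \<beta> k * \<beta> k * z) mod f = c" by blast
      then show ?thesis
        by (intro coverI[of "[Inl (i, x), Inl (j, y), Inl (k, z)]"])
          (use 4 js ijk in \<open>auto simp: v_def poly_mod_add_left add.assoc\<close>)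
    qed
  qed
  moreover have "inj_on (lift3_column h \<beta> s) (lift3_index J I)"
    by (auto simp: inj_on_def dest: inj_onD[OF h(2)] inj_onD[OF s(2)])
  moreover have "lift3_column h \<beta> s ` lift3_index J I \<subseteq> vecs (r + 3 * m) - {0}"
    by (auto intro!: join_in_vecs)
  ultimately show ?thesis by (simp add: column_system_def)
qed

lemma lift3_triangle:
  assumes "cover 3 3 I s \<kappa> 0"
  shows "cover 3 3 (lift3_index J I) (lift3_column h \<beta> s) (lift3_colour \<kappa>) 0"
proof -
  from assms obtain xs where xs: "set xs \<subseteq> I" "length xs = 3" "distinct (map \<kappa> xs)"
    "(\<Sum>x\<leftarrow>xs. s x) = 0" by (auto simp: cover_def)
  then show ?thesis
    by (intro coverI[of "map (\<lambda>i. Inr (Inr i)) xs"])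
      (auto simp: lift3_index_def comp_def distinct_map inj_on_def sum_list_join)
qed

text \<open>For fixed \<open>j\<close> the column is linear in \<open>x\<close> apart from its
  constant top, and three copies of that top add up to one. Hence it suffices to write
  \<open>x\<close> as a sum of three distinct residues; \<open>2 <= m\<close> provides at least four
  to choose from.\<close>

lemma lift3_column_dependent:
  assumes "2 \<le> m" and I: "\<And>i. i \<in> I \<Longrightarrow> cover 2 3 I s id (s i)" and k: "k \<in> lift3_index J I"
  shows "cover 2 3 (lift3_index J I) (lift3_column h \<beta> s) id (lift3_column h \<beta> s k)"
proof -
  have card: "4 \<le> card (vecs m)"
    using power_increasing[OF assms(1), of "2 :: nat"] by (simp add: card_vecs)
  have avoid: "\<exists>p\<in>vecs m. p \<notin> A" if "finite A" "card A < 4" for A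
    using card that by (meson card_mono linorder_not_less order_less_le_trans subsetI)
  from k consider (base) j x where "k = Inl (j, x)" "j \<in> J" "x \<in> vecs m"
    | (top) y where "k = Inr (Inl y)" "y \<in> vecs m" "y \<noteq> 0"
    | (inner) i where "k = Inr (Inr i)" "i \<in> I" by (auto simp: lift3_index_def)
  then show ?thesis
  proof cases
    case base
    \<comment> \<open>The third residue \<open>x + p + q\<close> differs from \<open>p\<close> and
      \<open>q\<close> because both of these differ from \<open>x\<close>.\<close>
    obtain p where p: "p \<in> vecs m" "p \<noteq> x" using avoid[of "{x}"] by auto
    obtain q where q: "q \<in> vecs m" "q \<noteq> x" "q \<noteq> p" using avoid[of "{x, p}"] p by auto
    have "p + (q + (x + p + q)) = x" by (simp add: ac_simps)
    moreover have "g * p mod f + (g * q mod f + g * (x + p + q) mod f) = g * x mod f" for g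
      by (simp add: algebra_simps flip: poly_mod_add_left)
    moreover have "x + p + q \<noteq> p" "x + p + q \<noteq> q"
      using p q bit_poly_add_eq_0_iff[of x q] bit_poly_add_eq_0_iff[of x p] by (auto simp: ac_simps)
    ultimately show ?thesis
      using base p q by (intro coverI[of "[Inl (j, p), Inl (j, q), Inl (j, x + p + q)]"])
        (auto simp: lift3_index_def join_add app_add)
  next
    case top
    \<comment> \<open>Avoiding \<open>y\<close> makes \<open>y + p\<close> nonzero; it differs from
      \<open>p\<close> because \<open>y\<close> is nonzero.\<close>
    obtain p where p: "p \<in> vecs m" "p \<noteq> 0" "p \<noteq> y" using avoid[of "{0, y}"] top by auto
    with top show ?thesis
      by (intro coverI[of "[Inr (Inl p), Inr (Inl (y + p))]"])
        (auto simp: lift3_index_def join_add bit_poly_add_eq_0_iff ac_simps)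
  next
    case inner
    from I[OF inner(2)] obtain xs where xs: "set xs \<subseteq> I" "2 \<le> length xs" "length xs \<le> 3" "distinct xs"
      "(\<Sum>x\<leftarrow>xs. s x) = s i" by (auto simp: cover_def)
    with inner show ?thesis
      by (intro coverI[of "map (\<lambda>i. Inr (Inr i)) xs"])
        (auto simp: lift3_index_def comp_def distinct_map inj_on_def sum_list_join)
  qed
qed

end

section \<open>Parity-check matrices\<close>

lemma cover_mono: "cover l R I s \<kappa> v \<Longrightarrow> l' \<le> l \<Longrightarrow> R \<le> R' \<Longrightarrow> cover l' R' I s \<kappa> v"
  by (auto simp: cover_def)

lemma cover_reindex:
  assumes e: "bij_betw e N I" and "cover l R I s \<kappa> v"
  shows "cover l R N (s \<circ> e) (\<kappa> \<circ> e) v"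
proof -
  from assms obtain xs where xs: "set xs \<subseteq> I" "l \<le> length xs" "length xs \<le> R"
    "distinct (map \<kappa> xs)" "(\<Sum>x\<leftarrow>xs. s x) = v" by (auto simp: cover_def)
  define ys where "ys = map (inv_into N e) xs"
  have "map e ys = xs"
    using xs(1) e by (auto simp: ys_def map_idI f_inv_into_f bij_betw_def subset_iff)
  then have "map (\<kappa> \<circ> e) ys = map \<kappa> xs" "map (s \<circ> e) ys = map s xs"
    by (simp_all flip: map_map)
  moreover have "length ys = length xs" by (simp add: ys_def)
  moreover have "set ys \<subseteq> N"
    using xs(1) e by (auto simp: ys_def bij_betw_def intro!: inv_into_into)
  ultimately show ?thesis
    using xs by (intro coverI[of ys]) (simp_all only:)
qed

lemma column_system_reindex:
  assumes e: "bij_betw e N I" and sys: "column_system R r I s \<kappa>"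
  shows "column_system R r N (s \<circ> e) (\<kappa> \<circ> e)"
proof -
  have "e ` N = I" "inj_on e N" using e by (auto simp: bij_betw_def)
  moreover have "cover 0 R N (s \<circ> e) (\<kappa> \<circ> e) v" if "v \<in> vecs r" for v
    using sys that by (intro cover_reindex[OF e]) (simp add: column_system_def)
  ultimately show ?thesis
    using sys bij_betw_finite[OF e] by (auto simp: column_system_def comp_inj_on)
qed

definition matrix_of :: "nat \<Rightarrow> (nat \<Rightarrow> bit poly) \<Rightarrow> nat \<Rightarrow> nat \<Rightarrow> bit" where
  "matrix_of n c i j = (if j < n then coeff (c j) i else 0)"

lemma colsum_matrix_of: "S \<subseteq> {0..<n} \<Longrightarrow> colsum (matrix_of n c) S = coeff (\<Sum>j\<in>S. c j)"
  by (rule ext) (auto simp: colsum_def matrix_of_def coeff_sum intro!: sum.cong)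

lemma is_vec_coeff:
  assumes "is_vec r v"
  obtains p where "p \<in> vecs r" "coeff p = v"
proof
  have c: "coeff (Poly (map v [0..<r])) = v"
    using assms by (auto simp: fun_eq_iff nth_default_def is_vec_def coeff_Poly_eq)
  then show "coeff (Poly (map v [0..<r])) = v" .
  show "Poly (map v [0..<r]) \<in> vecs r" using assms by (simp only: vecs_def c mem_Collect_eq)
qed

lemma cover_set:
  assumes "cover l R I s \<kappa> v"
  obtains T where "T \<subseteq> I" "finite T" "l \<le> card T" "card T \<le> R" "inj_on \<kappa> T" "(\<Sum>i\<in>T. s i) = v"
proof -
  from assms obtain xs where xs: "set xs \<subseteq> I" "l \<le> length xs" "length xs \<le> R"
    "distinct (map \<kappa> xs)" "(\<Sum>x\<leftarrow>xs. s x) = v" by (auto simp: cover_def)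
  then have d: "distinct xs" "inj_on \<kappa> (set xs)" by (auto simp: distinct_map)
  show thesis
    by (rule that[of "set xs"]) (use xs d in \<open>auto simp: distinct_card sum_list_distinct_conv_sum_set\<close>)
qed

text \<open>The subsets are the fibres of \<mu>; a set of columns meets each fibre at most once
  exactly when \<mu> is injective on it.\<close>

lemma RL_partition_matrix_of:
  assumes "\<And>v. v \<in> vecs r \<Longrightarrow> cover l R {0..<n} c \<mu> v"
  shows "RL_partition (matrix_of n c) r n R l ((\<lambda>a. {j \<in> {0..<n}. \<mu> j = a}) ` \<mu> ` {0..<n})"
  unfolding RL_partition_def
proof (intro conjI allI impI)
  show "partition_on {0..<n} ((\<lambda>a. {j \<in> {0..<n}. \<mu> j = a}) ` \<mu> ` {0..<n})"
    by (auto intro!: partition_onI simp: disjnt_def)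
next
  fix v assume "is_vec r v"
  then obtain p where p: "p \<in> vecs r" "coeff p = v" by (rule is_vec_coeff)
  from assms[OF p(1)] obtain T where T: "T \<subseteq> {0..<n}" "finite T" "l \<le> card T" "card T \<le> R"
    "inj_on \<mu> T" "(\<Sum>i\<in>T. c i) = p" by (rule cover_set)
  have "card (T \<inter> {j \<in> {0..<n}. \<mu> j = a}) \<le> 1" for a
    using T(2,5) by (intro card_le_Suc0_iff_eq[THEN iffD2, unfolded One_nat_def[symmetric]])
      (auto dest: inj_onD)
  with T p show "\<exists>S\<subseteq>{0..<n}. l \<le> card S \<and> card S \<le> R \<and> colsum (matrix_of n c) S = v \<and>
      (\<forall>A\<in>(\<lambda>a. {j \<in> {0..<n}. \<mu> j = a}) ` \<mu> ` {0..<n}. card (S \<inter> A) \<le> 1)"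
    by (intro exI[of _ T]) (simp add: colsum_matrix_of)
qed

lemma colsum_matrix_of_eq_0:
  "S \<subseteq> {0..<n} \<Longrightarrow> colsum (matrix_of n c) S = (\<lambda>_. 0) \<longleftrightarrow> (\<Sum>j\<in>S. c j) = 0"
  by (simp add: colsum_matrix_of poly_eq_iff fun_eq_iff)

text \<open>Weight 1 would give a zero column and weight 2 two equal columns; three columns with sum
  zero form a word of weight 3.\<close>

lemma min_dist_matrix_of:
  assumes sys: "column_system 3 r {0..<n} c \<kappa>" and tri: "cover 3 3 {0..<n} c \<kappa> 0"
  shows "min_dist (matrix_of n c) n 3"
  unfolding min_dist_def
proof (intro conjI allI impI)
  from tri obtain T where "T \<subseteq> {0..<n}" "finite T" "3 \<le> card T" "card T \<le> 3" "(\<Sum>i\<in>T. c i) = 0"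
    by (rule cover_set)
  then show "\<exists>x. x \<noteq> {} \<and> x \<subseteq> {0..<n} \<and> colsum (matrix_of n c) x = (\<lambda>_. 0) \<and> card x = 3"
    by (intro exI[of _ T]) (auto simp: colsum_matrix_of_eq_0)
next
  fix x assume x: "x \<noteq> {} \<and> x \<subseteq> {0..<n} \<and> colsum (matrix_of n c) x = (\<lambda>_. 0)"
  then have sum: "(\<Sum>j\<in>x. c j) = 0" using colsum_matrix_of_eq_0[of x n c] by blast
  have fin: "finite x" using x by (meson finite_atLeastLessThan finite_subset)
  show "3 \<le> card x"
  proof (rule ccontr)
    assume "\<not> 3 \<le> card x"
    moreover have "card x \<noteq> 0" using x fin by simp
    ultimately have "card x = 1 \<or> card x = 2" by linarith
    then show False
    proof
      assume "card x = 1"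
      then obtain i where "x = {i}" by (auto simp: card_1_singleton_iff)
      with x sum sys show False by (auto simp: column_system_def image_subset_iff)
    next
      assume "card x = 2"
      then obtain i j where ij: "x = {i, j}" "i \<noteq> j" by (auto simp: card_2_iff)
      with sum have "c i = c j" by (simp add: bit_poly_add_eq_0_iff)
      with x ij sys show False by (auto simp: column_system_def dest: inj_onD)
    qed
  qed
qed

text \<open>Radius at most 2 is excluded by counting: sums of at most two columns take at most
  \<open>(n + 1)^2\<close> values.\<close>

lemma covering_radius_matrix_of:
  assumes cov: "\<And>v. v \<in> vecs r \<Longrightarrow> cover 0 3 {0..<n} c \<kappa> v" and n: "(n + 1)\<^sup>2 < 2 ^ r"
  shows "covering_radius (matrix_of n c) r n 3"
  unfolding covering_radius_def
proof (intro conjI allI impI notI)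
  show "covered_within (matrix_of n c) r n 3"
    using RL_partition_matrix_of[OF cov] unfolding RL_partition_def covered_within_def by blast
next
  fix R' :: nat assume R': "R' < 3" "covered_within (matrix_of n c) r n R'"
  \<comment> \<open>The extra index \<open>n\<close> stands for the zero vector, so that sums of 0,
    1 or 2 columns all become sums of two values of \<open>c'\<close>.\<close>
  define c' where "c' j = (if j < n then c j else 0)" for j
  have "vecs r \<subseteq> (\<lambda>(i, j). c' i + c' j) ` ({..n} \<times> {..n})"
  proof
    fix p assume "p \<in> vecs r"
    then have "is_vec r (coeff p)" by (simp add: vecs_def)
    with R'(2) obtain S where S: "S \<subseteq> {0..<n}" "card S \<le> R'" "colsum (matrix_of n c) S = coeff p"
      unfolding covered_within_def by blast
    then have p: "(\<Sum>j\<in>S. c j) = p" by (simp add: colsum_matrix_of coeff_inject)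
    have fin: "finite S" using S(1) by (meson finite_atLeastLessThan finite_subset)
    have "card S = 0 \<or> card S = 1 \<or> card S = 2" using S(2) R'(1) by linarith
    then consider "S = {}" | i where "S = {i}" | i j where "S = {i, j}" "i \<noteq> j"
      using fin by (auto simp: card_1_singleton_iff card_2_iff)
    then have "\<exists>i\<le>n. \<exists>j\<le>n. p = c' i + c' j"
    proof cases
      case 1
      then show ?thesis using p by (intro exI[of _ n]) (auto simp: c'_def)
    next
      case (2 i)
      then show ?thesis using p S(1) by (intro exI[of _ i] conjI exI[of _ n]) (auto simp: c'_def)
    next
      case (3 i j)
      then show ?thesis using p S(1) by (intro exI[of _ i] conjI exI[of _ j]) (auto simp: c'_def)
    qed
    then show "p \<in> (\<lambda>(i, j). c' i + c' j) ` ({..n} \<times> {..n})" by force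
  qed
  then have "card (vecs r) \<le> card ({..n} \<times> {..n})"
    by (intro surj_card_le) auto
  also have "\<dots> = (n + 1)\<^sup>2" by (simp add: card_cartesian_product power2_eq_square)
  finally show False using n by (simp add: card_vecs)
qed

lemma is_matrix_matrix_of: "c ` {0..<n} \<subseteq> vecs r \<Longrightarrow> is_matrix r n (matrix_of n c)"
  by (auto simp: is_matrix_def matrix_of_def vecs_def is_vec_def image_subset_iff)

lemma ell2_le: "is_matrix r n H \<Longrightarrow> covering_radius H r n R \<Longrightarrow> ell2 r R \<le> n"
  unfolding ell2_def by (rule Least_le) blast

text \<open>A nonzero vector is never the empty sum, and zero is the sum of the three columns
  given.\<close>

lemma cover_pos:
  assumes "v \<in> vecs r" "column_system 3 r I s \<kappa>" "cover 3 3 I s \<kappa> 0"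
  shows "cover 1 3 I s \<kappa> v"
proof (cases "v = 0")
  case True
  with assms(3) show ?thesis by (auto elim: cover_mono)
next
  case False
  from assms(1,2) obtain xs where "set xs \<subseteq> I" "length xs \<le> 3" "distinct (map \<kappa> xs)"
    "(\<Sum>x\<leftarrow>xs. s x) = v" by (auto simp: column_system_def cover_def)
  with False show ?thesis by (intro coverI[of xs]) (auto simp: Suc_le_eq)
qed

text \<open>A representation by one column is replaced by one with two or three columns. These may
  share colours, whence the colouring \<open>id\<close>, that is, the partition into
  singletons.\<close>

lemma cover_two:
  assumes "v \<in> vecs r" "column_system 3 r I s \<kappa>" "cover 3 3 I s \<kappa> 0"
    and dep: "\<And>i. i \<in> I \<Longrightarrow> cover 2 3 I s id (s i)"
  shows "cover 2 3 I s id v"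
proof -
  from cover_pos[OF assms(1-3)] obtain xs where xs: "set xs \<subseteq> I" "1 \<le> length xs" "length xs \<le> 3"
    "distinct (map \<kappa> xs)" "(\<Sum>x\<leftarrow>xs. s x) = v" by (auto simp: cover_def)
  show ?thesis
  proof (cases "length xs = 1")
    case True
    then obtain i where "xs = [i]" by (auto simp: length_Suc_conv)
    with xs dep show ?thesis by auto
  next
    case False
    with xs show ?thesis by (intro coverI[of xs]) (auto simp: distinct_map)
  qed
qed

text \<open>The fibres of \<kappa> serve both for \<open>l = 0\<close> and for \<open>l = 1\<close>.
  The claim for \<open>l = 2\<close> is conditional, since the dependence of single columns is
  established only for the code of length 818.\<close>

proposition realization:
  assumes sys: "column_system 3 r I s \<kappa>" and tri: "cover 3 3 I s \<kappa> 0"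
    and n: "card I = n" "(n + 1)\<^sup>2 < 2 ^ r" and p: "card (\<kappa> ` I) \<le> p"
  obtains H where "is_matrix r n H" "min_dist H n 3" "covering_radius H r n 3"
    "\<exists>P. RL_partition H r n 3 0 P \<and> card P \<le> p" "\<exists>P. RL_partition H r n 3 1 P \<and> card P \<le> p"
    "(\<forall>i\<in>I. cover 2 3 I s id (s i)) \<longrightarrow> (\<exists>P. RL_partition H r n 3 2 P)"
proof -
  have "finite I" using sys by (simp add: column_system_def)
  with n(1) obtain e where e: "bij_betw e {0..<n} I" using ex_bij_betw_nat_finite by blast
  define H where "H = matrix_of n (s \<circ> e)"
  note sys' = column_system_reindex[OF e sys] and tri' = cover_reindex[OF e tri]
  have "card ((\<lambda>a. {j \<in> {0..<n}. (\<kappa> \<circ> e) j = a}) ` (\<kappa> \<circ> e) ` {0..<n}) \<le> p"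
    (is "card ?P \<le> p")
  proof -
    have "(\<kappa> \<circ> e) ` {0..<n} = \<kappa> ` I" using e by (simp only: bij_betw_def flip: image_comp)
    with p have "card ((\<kappa> \<circ> e) ` {0..<n}) \<le> p" by simp
    moreover have "card ?P \<le> card ((\<kappa> \<circ> e) ` {0..<n})" by (intro card_image_le) simp
    ultimately show ?thesis by linarith
  qed
  have cov: "cover 0 3 {0..<n} (s \<circ> e) (\<kappa> \<circ> e) v" "cover 1 3 {0..<n} (s \<circ> e) (\<kappa> \<circ> e) v"
    if "v \<in> vecs r" for v
    using cover_pos[OF that sys' tri'] by (auto elim: cover_mono)
  have "RL_partition H r n 3 0 ?P" "RL_partition H r n 3 1 ?P"
    unfolding H_def by (rule RL_partition_matrix_of, erule cov)+
  with \<open>card ?P \<le> p\<close> have "\<exists>P. RL_partition H r n 3 0 P \<and> card P \<le> p"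
    "\<exists>P. RL_partition H r n 3 1 P \<and> card P \<le> p"
    by blast+
  moreover have "(\<forall>i\<in>I. cover 2 3 I s id (s i)) \<longrightarrow> (\<exists>P. RL_partition H r n 3 2 P)"
  proof
    assume dep: "\<forall>i\<in>I. cover 2 3 I s id (s i)"
    have "cover 2 3 {0..<n} (s \<circ> e) (id \<circ> e) v" if "v \<in> vecs r" for v
      by (rule cover_reindex[OF e cover_two[OF that sys tri]]) (use dep in blast)
    from RL_partition_matrix_of[OF this] show "\<exists>P. RL_partition H r n 3 2 P"
      unfolding H_def by (rule exI)
  qed
  moreover have "covering_radius H r n 3"
    unfolding H_def by (rule covering_radius_matrix_of[OF cov(1) n(2)])
  moreover have "min_dist H n 3" "is_matrix r n H"
    unfolding H_def using min_dist_matrix_of[OF sys' tri'] sys'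
    by (auto simp: column_system_def image_subset_iff intro!: is_matrix_matrix_of)
  ultimately show thesis by (intro that[of H])
qed

section \<open>Verification by computation\<close>

text \<open>Bit lists are the executable form of polynomials, constant coefficient first.\<close>

primrec pol :: "bool list \<Rightarrow> bit poly" where
  "pol [] = 0"
| "pol (b # bs) = pCons (of_bool b) (pol bs)"

fun ladd :: "bool list \<Rightarrow> bool list \<Rightarrow> bool list" where
  "ladd [] ys = ys"
| "ladd xs [] = xs"
| "ladd (x # xs) (y # ys) = (x \<noteq> y) # ladd xs ys"

primrec lmul :: "bool list \<Rightarrow> bool list \<Rightarrow> bool list" where
  "lmul [] ys = []"
| "lmul (x # xs) ys = ladd (if x then ys else []) (False # lmul xs ys)"

primrec bin :: "nat \<Rightarrow> nat \<Rightarrow> bool list" where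
  "bin 0 n = []"
| "bin (Suc k) n = odd n # bin k (n div 2)"

text \<open>Descends the binary tree of prefixes and asks that every branch of depth
  \<open>k\<close> be reached, which avoids searching \<open>L\<close> for each of the
  \<open>2 ^ k\<close> vectors.\<close>

primrec full :: "nat \<Rightarrow> bool list list \<Rightarrow> bool" where
  "full 0 L \<longleftrightarrow> L \<noteq> []"
| "full (Suc k) L \<longleftrightarrow> full k (map tl (filter hd L)) \<and> full k (map tl (filter (Not \<circ> hd) L))"

text \<open>
  \<open>csums z n L\<close> lists the sums of at most \<open>n\<close> vectors of \<open>L\<close> with distinct colours, each with its
  increasing list of colours. To check that the sumset of two such lists is everything, the pairs
  of lists are first split along \<open>d\<close> leading bits and the sums are only expanded afterwards; this
  keeps the terms small enough for rewriting.
\<close>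

primrec csums :: "bool list \<Rightarrow> nat \<Rightarrow> (nat \<times> bool list) list \<Rightarrow> (nat list \<times> bool list) list" where
  "csums z 0 L = [([], z)]"
| "csums z (Suc n) L = ([], z) # concat (map (\<lambda>(a, x). map (\<lambda>(as, y). (a # as, ladd x y))
     (csums z n (filter (\<lambda>(b, y). a < b) L))) L)"

definition branch :: "bool \<Rightarrow> ('a \<times> bool list) list \<Rightarrow> ('a \<times> bool list) list" where
  "branch b A = map (apsnd tl) (filter (\<lambda>(a, x). hd x = b) A)"

definition nonempty :: "'a list \<Rightarrow> 'b list \<Rightarrow> ('a list \<times> 'b list) list" where
  "nonempty A B = (if A = [] \<or> B = [] then [] else [(A, B)])"

text \<open>Strict increase of the joined colour lists guarantees distinct colours; up to the order
  of the columns it loses no combination.\<close>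

definition pairsums :: "((nat list \<times> bool list) list \<times> (nat list \<times> bool list) list) list \<Rightarrow> bool list list" where
  "pairsums S = concat (map (\<lambda>(A, B). concat (map (\<lambda>(as, x).
     concat (map (\<lambda>(bs, y). if sorted_wrt (<) (as @ bs) then [ladd x y] else []) B)) A)) S)"

text \<open>The conjuncts of the second clause treat the two values of the leading bit of a sum: it
  is 0 when the leading bits of the summands agree and 1 when they differ.\<close>

primrec sumset_full :: "nat \<Rightarrow> nat \<Rightarrow> ((nat list \<times> bool list) list \<times> (nat list \<times> bool list) list) list \<Rightarrow> bool" where
  "sumset_full k 0 S \<longleftrightarrow> full k (pairsums S)"
| "sumset_full k (Suc d) S \<longleftrightarrow>
     sumset_full k d (concat (map (\<lambda>(A, B). nonempty (branch False A) (branch False B) @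
       nonempty (branch True A) (branch True B)) S)) \<and>
     sumset_full k d (concat (map (\<lambda>(A, B). nonempty (branch False A) (branch True B) @
       nonempty (branch True A) (branch False B)) S))"

lemma pol_ladd: "pol (ladd xs ys) = pol xs + pol ys"
  by (induction xs ys rule: ladd.induct) auto

lemma pol_lmul: "pol (lmul xs ys) = pol xs * pol ys"
  by (induction xs) (auto simp: pol_ladd)

lemma pol_eq_0: "pol xs = 0 \<longleftrightarrow> True \<notin> set xs"
  by (induction xs) auto

lemma pol_inject: "length xs = length ys \<Longrightarrow> pol xs = pol ys \<longleftrightarrow> xs = ys"
  by (induction xs ys rule: list_induct2) (auto simp: of_bool_def split: if_splits)

lemma length_ladd: "length xs = k \<Longrightarrow> length ys = k \<Longrightarrow> length (ladd xs ys) = k"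
  by (induction xs ys arbitrary: k rule: ladd.induct) auto

lemma length_bin [simp]: "length (bin k n) = k"
  by (induction k arbitrary: n) auto

lemma pol_in_vecs: "length xs = r \<Longrightarrow> pol xs \<in> vecs r"
  by (induction xs arbitrary: r) (auto simp: vecs_0 vecs_Suc)

lemma vecs_polE:
  assumes "p \<in> vecs r"
  obtains xs where "length xs = r" "p = pol xs"
proof -
  from assms have "\<exists>xs. length xs = r \<and> p = pol xs"
  proof (induction r arbitrary: p)
    case (Suc r)
    then obtain b q where p: "p = pCons b q" "q \<in> vecs r"
      by (auto simp: vecs_Suc)
    with Suc.IH obtain xs where "length xs = r" "q = pol xs" by blast
    with p show ?case by (intro exI[of _ "(b = 1) # xs"]) (cases b, auto)
  qed (auto simp: vecs_0)
  with that show thesis by blast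
qed

lemma full_mem:
  "full k L \<Longrightarrow> length xs = k \<Longrightarrow> \<forall>ys\<in>set L. length ys = k \<Longrightarrow> xs \<in> set L"
proof (induction k arbitrary: L xs)
  case 0
  then show ?case by (cases L) auto
next
  case (Suc k)
  from Suc.prems(2) obtain b zs where xs: "xs = b # zs" "length zs = k" by (cases xs) auto
  define M where "M = map tl (filter (if b then hd else Not \<circ> hd) L)"
  have "full k M" using Suc.prems(1) by (cases b) (simp_all add: M_def)
  moreover have "\<forall>ys\<in>set M. length ys = k" using Suc.prems(3) by (auto simp: M_def)
  ultimately have "zs \<in> set M" using Suc.IH xs by blast
  then obtain ys where ys: "ys \<in> set L" "hd ys = b" "zs = tl ys"
    by (auto simp: M_def split: if_splits)
  then have "ys \<noteq> []" using Suc.prems(3) by auto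
  moreover have "xs = hd ys # tl ys" using ys xs by simp
  ultimately have "xs = ys" by simp
  with ys show ?case by simp
qed

lemma csums_sound:
  assumes "(as, x) \<in> set (csums z n L)" "length z = k" "\<forall>p\<in>set L. length (snd p) = k"
  shows "length x = k \<and> (\<exists>ps. set ps \<subseteq> set L \<and> length ps \<le> n \<and> map fst ps = as \<and>
     pol x = pol z + (\<Sum>p\<leftarrow>ps. pol (snd p)))"
  using assms
proof (induction n arbitrary: as x L)
  case 0
  then show ?case by auto
next
  case (Suc n)
  show ?case
  proof (cases "as = []")
    case True
    with Suc.prems show ?thesis by (auto intro: exI[of _ "[]"])
  next
    case False
    with Suc.prems(1) obtain a y bs w where w: "(a, y) \<in> set L" "as = a # bs" "x = ladd y w"
      "(bs, w) \<in> set (csums z n (filter (\<lambda>(b, y). a < b) L))" by auto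
    from Suc.IH[OF w(4)] Suc.prems obtain ps where ps: "length w = k"
      "set ps \<subseteq> set (filter (\<lambda>(b, y). a < b) L)" "length ps \<le> n" "map fst ps = bs"
      "pol w = pol z + (\<Sum>p\<leftarrow>ps. pol (snd p))" by auto
    have "length y = k" using w(1) Suc.prems(3) by auto
    with w ps show ?thesis
      by (intro conjI exI[of _ "(a, y) # ps"]) (auto simp: pol_ladd length_ladd ac_simps)
  qed
qed

lemma branch_mem:
  assumes "(as, x) \<in> set (branch b A)" "\<forall>p\<in>set A. length (snd p) = Suc k"
  shows "(as, b # x) \<in> set A" "length x = k"
proof -
  from assms obtain y where y: "(as, y) \<in> set A" "hd y = b" "x = tl y" by (auto simp: branch_def)
  with assms(2) have "length y = Suc k" by auto
  with y show "(as, b # x) \<in> set A" "length x = k" by (cases y; auto)+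
qed

lemma sumset_full_sound:
  assumes "sumset_full k d S" "length xs = k + d"
    and "\<forall>(A, B)\<in>set S. (\<forall>p\<in>set A. length (snd p) = k + d) \<and> (\<forall>p\<in>set B. length (snd p) = k + d)"
  shows "\<exists>A B as x bs y. (A, B) \<in> set S \<and> (as, x) \<in> set A \<and> (bs, y) \<in> set B \<and>
     sorted_wrt (<) (as @ bs) \<and> xs = ladd x y"
  using assms
proof (induction d arbitrary: S xs)
  case 0
  have "\<forall>ys\<in>set (pairsums S). length ys = k"
    using 0(3) by (fastforce simp: pairsums_def intro!: length_ladd split: if_splits)
  with 0 have "xs \<in> set (pairsums S)" by (auto intro: full_mem)
  then show ?case by (fastforce simp: pairsums_def split: if_splits)
next
  case (Suc d)
  from Suc.prems(2) obtain b zs where xs: "xs = b # zs" "length zs = k + d" by (cases xs) auto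
  define S' where "S' = concat (map (\<lambda>(A, B). nonempty (branch False A) (branch b B) @
       nonempty (branch True A) (branch (\<not> b) B)) S)"
  have full: "sumset_full k d S'" using Suc.prems(1) by (cases b) (simp_all add: S'_def)
  \<comment> \<open>If the first summand starts with \<open>c\<close>, then the second must start
    with the exclusive or of \<open>b\<close> and \<open>c\<close>.\<close>
  have S': "\<exists>A B c. (A, B) \<in> set S \<and> A' = branch c A \<and> B' = branch (b \<noteq> c) B"
    if "(A', B') \<in> set S'" for A' B'
  proof -
    from that obtain A B where AB: "(A, B) \<in> set S" and "A' = branch False A \<and> B' = branch b B \<or>
        A' = branch True A \<and> B' = branch (\<not> b) B"
      by (auto simp: S'_def nonempty_def split: if_splits)
    then show ?thesis
    proof (elim disjE)
      assume "A' = branch False A \<and> B' = branch b B"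
      with AB show ?thesis by (intro exI[of _ A] exI[of _ B] exI[of _ False]) simp
    next
      assume "A' = branch True A \<and> B' = branch (\<not> b) B"
      with AB show ?thesis by (intro exI[of _ A] exI[of _ B] exI[of _ True]) simp
    qed
  qed
  have "\<forall>(A, B)\<in>set S'. (\<forall>p\<in>set A. length (snd p) = k + d) \<and> (\<forall>p\<in>set B. length (snd p) = k + d)"
  proof (clarify, intro conjI ballI)
    fix A' B' assume "(A', B') \<in> set S'"
    from S'[OF this] obtain A B c where AB: "(A, B) \<in> set S" "A' = branch c A" "B' = branch (b \<noteq> c) B"
      by blast
    then have len: "\<forall>p\<in>set A. length (snd p) = Suc (k + d)" "\<forall>p\<in>set B. length (snd p) = Suc (k + d)"
      using Suc.prems(3) by auto
    show "length (snd p) = k + d" if "p \<in> set A'" for p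
      using branch_mem(2)[OF _ len(1), of "fst p" "snd p"] that AB by simp
    show "length (snd p) = k + d" if "p \<in> set B'" for p
      using branch_mem(2)[OF _ len(2), of "fst p" "snd p"] that AB by simp
  qed
  from Suc.IH[OF full xs(2) this] obtain A' B' as x bs y where 1: "(A', B') \<in> set S'"
    "(as, x) \<in> set A'" "(bs, y) \<in> set B'" "sorted_wrt (<) (as @ bs)" "zs = ladd x y" by blast
  from S'[OF 1(1)] obtain A B c where AB: "(A, B) \<in> set S" "A' = branch c A" "B' = branch (b \<noteq> c) B"
    by blast
  then have len: "\<forall>p\<in>set A. length (snd p) = Suc (k + d)" "\<forall>p\<in>set B. length (snd p) = Suc (k + d)"
    using Suc.prems(3) by auto
  have "(as, c # x) \<in> set A"
    using 1(2) AB(2) by (intro branch_mem(1)[OF _ len(1)]) simp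
  moreover have "(bs, (b \<noteq> c) # y) \<in> set B"
    using 1(3) AB(3) by (intro branch_mem(1)[OF _ len(2)]) simp
  moreover have "xs = ladd (c # x) ((b \<noteq> c) # y)" using xs 1 by auto
  ultimately show ?case using AB(1) 1(4) by (intro exI conjI)
qed

text \<open>Covering by \<open>l + l'\<close> columns is tested as a sumset of sums of at most
  \<open>l\<close> and at most \<open>l'\<close> columns; \<open>d\<close> bits are split off first
  and \<open>k\<close> remain for \<open>full\<close>.\<close>

lemma column_system_list:
  assumes L: "list_all (\<lambda>(a, x). length x = k + d \<and> True \<in> set x) L" "distinct (map snd L)"
    and full: "sumset_full k d [(csums (bin (k + d) 0) l L, csums (bin (k + d) 0) l' L)]"
  shows "column_system (l + l') (k + d) {0..<length L} (\<lambda>i. pol (snd (L ! i))) (\<lambda>i. fst (L ! i))"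
proof -
  have len: "length (snd (L ! i)) = k + d" "True \<in> set (snd (L ! i))" if "i < length L" for i
    using L(1) that by (auto simp: list_all_length case_prod_beta)
  have len': "\<forall>p\<in>set L. length (snd p) = k + d"
    using L(1) by (auto simp: list_all_iff case_prod_beta)
  have z: "pol (bin j 0) = 0" for j by (induction j) auto
  have "cover 0 (l + l') {0..<length L} (\<lambda>i. pol (snd (L ! i))) (\<lambda>i. fst (L ! i)) v"
    if "v \<in> vecs (k + d)" for v
  proof -
    from that obtain xs where xs: "length xs = k + d" "v = pol xs" by (rule vecs_polE)
    have lenc: "length (snd p) = k + d" if "p \<in> set (csums (bin (k + d) 0) n L)" for n p
      using csums_sound[OF _ _ len', of "fst p" "snd p" "bin (k + d) 0" n] that by simp
    have "\<forall>(A, B)\<in>set [(csums (bin (k + d) 0) l L, csums (bin (k + d) 0) l' L)].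
        (\<forall>p\<in>set A. length (snd p) = k + d) \<and> (\<forall>p\<in>set B. length (snd p) = k + d)"
      using lenc by simp
    from sumset_full_sound[OF full xs(1) this] obtain as x bs y where
      1: "(as, x) \<in> set (csums (bin (k + d) 0) l L)" "(bs, y) \<in> set (csums (bin (k + d) 0) l' L)"
      "sorted_wrt (<) (as @ bs)" "xs = ladd x y" by auto
    obtain ps qs where ps: "set ps \<subseteq> set L" "length ps \<le> l" "map fst ps = as"
        "pol x = (\<Sum>p\<leftarrow>ps. pol (snd p))"
      and qs: "set qs \<subseteq> set L" "length qs \<le> l'" "map fst qs = bs"
        "pol y = (\<Sum>p\<leftarrow>qs. pol (snd p))"
      using csums_sound[OF 1(1) _ len'] csums_sound[OF 1(2) _ len'] by (auto simp: z)
    have "set L = (\<lambda>i. L ! i) ` {0..<length L}" by (metis list.set_map map_nth set_upt)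
    then have "ps @ qs \<in> lists ((\<lambda>i. L ! i) ` {0..<length L})"
      using ps(1) qs(1) by (auto simp: in_lists_conv_set)
    then obtain js where js: "set js \<subseteq> {0..<length L}" "ps @ qs = map (\<lambda>i. L ! i) js"
      by (auto simp: lists_image)
    have "distinct (as @ bs)" using 1(3) strict_sorted_iff by blast
    moreover have "as @ bs = map (\<lambda>i. fst (L ! i)) js"
      using arg_cong[OF js(2), of "map fst"] ps qs by (simp add: comp_def)
    moreover have "v = (\<Sum>i\<leftarrow>js. pol (snd (L ! i)))"
      using arg_cong[OF js(2), of "\<lambda>ps. \<Sum>p\<leftarrow>ps. pol (snd p)"] ps qs 1 xs
      by (simp add: comp_def pol_ladd)
    moreover have "length js \<le> l + l'"
      using arg_cong[OF js(2), of length] ps qs by simp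
    ultimately show ?thesis using js(1) by (intro coverI[of js]) auto
  qed
  moreover have "inj_on (\<lambda>i. pol (snd (L ! i))) {0..<length L}"
  proof (rule inj_onI)
    fix i j assume ij: "i \<in> {0..<length L}" "j \<in> {0..<length L}" "pol (snd (L ! i)) = pol (snd (L ! j))"
    then have "map snd L ! i = map snd L ! j" by (simp add: pol_inject len)
    with ij L(2) show "i = j" using nth_eq_iff_index_eq[of "map snd L" i j] by simp
  qed
  moreover have "(\<lambda>i. pol (snd (L ! i))) ` {0..<length L} \<subseteq> vecs (k + d) - {0}"
    using len by (auto simp: pol_in_vecs pol_eq_0)
  ultimately show ?thesis by (simp add: column_system_def)
qed

text \<open>Each entry certifies one inverse by a polynomial identity, and \<open>full\<close>
  certifies that no nonzero \<open>g\<close> is missing from the table.\<close>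

lemma unit_mod_table:
  assumes full: "full k (bin k 0 # map (\<lambda>(g, u, q). bin k g) T)"
    and T: "list_all (\<lambda>(g, u, q). True \<notin> set (ladd (ladd (lmul (bin k g) (bin m u)) [True])
              (lmul (bin (Suc m) F) (bin k q)))) T"
    and g: "g \<in> vecs k" "g \<noteq> 0"
  shows "unit_mod (pol (bin (Suc m) F)) g"
proof -
  from g(1) obtain xs where xs: "length xs = k" "g = pol xs" by (rule vecs_polE)
  have "xs \<in> set (bin k 0 # map (\<lambda>(g, u, q). bin k g) T)"
    by (rule full_mem[OF full xs(1)]) auto
  moreover have "pol (bin k 0) = 0" by (induction k) auto
  ultimately obtain n u q where "(n, u, q) \<in> set T" "xs = bin k n" using xs g(2) by auto
  with T have "pol (ladd (ladd (lmul xs (bin m u)) [True]) (lmul (bin (Suc m) F) (bin k q))) = 0"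
    unfolding pol_eq_0 by (auto simp: list_all_iff)
  then have "g * pol (bin m u) + 1 = pol (bin (Suc m) F) * pol (bin k q)"
    by (simp add: pol_ladd pol_lmul xs bit_poly_add_eq_0_iff flip: one_pCons)
  then show ?thesis unfolding unit_mod_def by (metis dvd_triv_left)
qed

section \<open>The codes\<close>

text \<open>
  The moduli are X^4 + X + 1, X^5 + X^2 + 1, X^9 + X^4 + 1 and X^10 + X^3 + 1, encoded as 19, 37,
  529 and 1033. A triple \<open>(g, u, q)\<close> records the identity \<open>g * u + 1 = f * q\<close> for the modulus \<open>f\<close>.
\<close>

definition inverses4 :: "(nat \<times> nat \<times> nat) list" where
  "inverses4 = [
     (1, 1, 0), (2, 9, 1), (3, 14, 1), (4, 13, 3), (5, 11, 2), (6, 7, 1), (7, 6, 1), (8, 15, 7),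
     (9, 2, 1), (10, 12, 7), (11, 5, 2), (12, 10, 7), (13, 4, 3), (14, 3, 1), (15, 8, 7)]"

definition inverses5 :: "(nat \<times> nat \<times> nat) list" where
  "inverses5 = [
     (1, 1, 0), (2, 18, 1), (3, 28, 1), (4, 9, 1), (5, 23, 2), (6, 14, 1), (7, 12, 1),
     (8, 22, 5), (9, 4, 1), (10, 25, 7), (11, 16, 5), (12, 7, 1), (13, 15, 2), (14, 6, 1),
     (15, 13, 2), (16, 11, 5), (17, 24, 13), (18, 2, 1), (19, 29, 14), (20, 30, 13),
     (21, 26, 15), (22, 8, 5), (23, 5, 2), (24, 17, 13), (25, 10, 7), (26, 21, 15), (27, 31, 8),
     (28, 3, 1), (29, 19, 14), (30, 20, 13), (31, 27, 8)]"

definition inverses9 :: "(nat \<times> nat \<times> nat) list" where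
  "inverses9 = [
     (1, 1, 0), (2, 264, 1), (3, 496, 1), (4, 132, 1), (5, 351, 2), (6, 248, 1), (7, 358, 3),
     (8, 66, 1), (9, 301, 4), (10, 423, 7), (11, 453, 6), (12, 124, 1), (13, 307, 6),
     (14, 179, 3), (15, 314, 7), (16, 33, 1), (17, 281, 8), (18, 414, 13), (19, 458, 15),
     (20, 475, 13), (21, 122, 3), (22, 490, 13), (23, 286, 11), (24, 62, 1), (25, 472, 9),
     (26, 401, 11), (27, 276, 13), (28, 337, 13), (29, 332, 13), (30, 157, 7), (31, 48, 1)]"

definition inverses10 :: "(nat \<times> nat \<times> nat) list" where
  "inverses10 = [
     (1, 1, 0), (2, 516, 1), (3, 1016, 1), (4, 258, 1), (5, 687, 2), (6, 508, 1), (7, 734, 3),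
     (8, 129, 1), (9, 589, 4), (10, 851, 7), (11, 184, 1), (12, 254, 1), (13, 232, 1),
     (14, 367, 3), (15, 610, 7), (16, 580, 9), (17, 478, 7), (18, 802, 13), (19, 214, 3),
     (20, 941, 13), (21, 242, 3), (22, 92, 1), (23, 88, 1), (24, 127, 1), (25, 977, 8),
     (26, 116, 1), (27, 572, 13), (28, 691, 13), (29, 104, 1), (30, 305, 7), (31, 399, 4)]"

lemma unit_mod_4:
  assumes "g \<in> vecs 4" "g \<noteq> 0"
  shows "unit_mod (pol (bin (Suc 4) 19)) g"
  by (rule unit_mod_table[OF _ _ assms, where T = inverses4]; code_simp)

lemma unit_mod_5:
  assumes "g \<in> vecs 5" "g \<noteq> 0"
  shows "unit_mod (pol (bin (Suc 5) 37)) g"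
  by (rule unit_mod_table[OF _ _ assms, where T = inverses5]; code_simp)

text \<open>The multipliers of the Golay columns are taken of degree below 5, a space closed under
  differences, so 31 inverses suffice although the modulus has degree 9.\<close>

lemma unit_mod_9:
  assumes "g \<in> vecs 5" "g \<noteq> 0"
  shows "unit_mod (pol (bin (Suc 9) 529)) g"
  by (rule unit_mod_table[OF _ _ assms, where T = inverses9]; code_simp)

lemma unit_mod_10:
  assumes "g \<in> vecs 5" "g \<noteq> 0"
  shows "unit_mod (pol (bin (Suc 10) 1033)) g"
  by (rule unit_mod_table[OF _ _ assms, where T = inverses10]; code_simp)

lemma degree_pol: "degree (pol (xs @ [True])) = length xs"
  by (induction xs) (auto simp: pol_eq_0 degree_pCons_eq)

lemma degree_pol_bin:
  assumes "last (bin (Suc m) F)"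
  shows "degree (pol (bin (Suc m) F)) = m"
proof -
  have "bin (Suc m) F = butlast (bin (Suc m) F) @ [True]"
    using assms append_butlast_last_id[of "bin (Suc m) F"] by (metis bin.simps(2) list.distinct(1))
  then show ?thesis by (metis degree_pol length_butlast length_bin diff_Suc_1)
qed

lemma degree_moduli:
  "degree (pol (bin (Suc 4) 19)) = 4" "degree (pol (bin (Suc 5) 37)) = 5"
  "degree (pol (bin (Suc 9) 529)) = 9" "degree (pol (bin (Suc 10) 1033)) = 10"
  by (rule degree_pol_bin, code_simp)+

text \<open>The powers of X (binary digits as coefficients) modulo the generator polynomial X^11 + X^10 + X^6 + X^5 + X^4 + X^2 + 1.\<close>

definition golay_cols :: "nat list" where
  "golay_cols = [1, 2, 4, 8, 16, 32, 64, 128, 256, 512, 1024, 1141, 1183, 1355, 1763, 435, 870,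
     1740, 493, 986, 1972, 797, 1594]"

text \<open>Pairs of a colour and a column, whose binary digits are the entries.\<close>

definition code51 :: "(nat \<times> nat) list" where
  "code51 = [(1, 531), (2, 13), (2, 832), (3, 192), (3, 385), (4, 74), (4, 117), (4, 313),
     (5, 6), (5, 11), (5, 256), (5, 838), (6, 111), (6, 295), (6, 387), (6, 425), (7, 446),
     (7, 749), (7, 793), (7, 806), (8, 69), (8, 731), (8, 753), (8, 797), (8, 823), (9, 512),
     (9, 562), (9, 576), (9, 929), (9, 960), (9, 979), (9, 993), (10, 79), (10, 90), (10, 286),
     (10, 386), (10, 407), (10, 758), (10, 814), (10, 827), (0, 739), (1, 545), (2, 845),
     (3, 722), (4, 917), (5, 843), (6, 938), (7, 915), (8, 946), (9, 1010), (10, 959)]"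

definition golay :: "nat \<Rightarrow> bit poly" where
  "golay i = pol (bin 11 (golay_cols ! i))"

definition column51 :: "nat \<Rightarrow> bit poly" where
  "column51 i = pol (bin 10 (snd (code51 ! i)))"

text \<open>
  For \<open>11 \<le> k \<le> 32\<close> this refines the colouring by 11 colours to one with exactly \<open>k\<close> colours: the last
  30 columns still carry all of the original colours.
\<close>

definition colour51 :: "nat \<Rightarrow> nat \<Rightarrow> nat" where
  "colour51 k i = (if i < k - 11 then 11 + i else fst (code51 ! i))"

text \<open>Since 1 + 23 + 253 + 1771 = 2^11, the sums of at most three columns can cover everything
  only without repetition: the code is perfect.\<close>

lemma golay_system: "column_system 3 11 {0..<23} golay id"
proof -
  let ?L = "zip [0..<23] (map (bin 11) golay_cols)"
  have len: "length golay_cols = 23" by code_simp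
  then have eq: "length ?L = 23" "1 + 2 = (3 :: nat)" "6 + 5 = (11 :: nat)" by simp_all
  have "column_system (1 + 2) (6 + 5) {0..<length ?L} (\<lambda>i. pol (snd (?L ! i))) (\<lambda>i. fst (?L ! i))"
  proof (rule column_system_list)
    show "list_all (\<lambda>(a, x). length x = 6 + 5 \<and> True \<in> set x) ?L" by code_simp
    show "distinct (map snd ?L)" by code_simp
    show "sumset_full 6 5 [(csums (bin (6 + 5) 0) 1 ?L, csums (bin (6 + 5) 0) 2 ?L)]"
      by code_simp
  qed
  then have "column_system 3 11 {0..<23} (\<lambda>i. pol (snd (?L ! i))) (\<lambda>i. fst (?L ! i))"
    unfolding eq .
  moreover have "pol (snd (?L ! i)) = golay i" "fst (?L ! i) = id i" if "i \<in> {0..<23}" for i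
    using that len by (simp_all add: golay_def)
  ultimately show ?thesis by (rule column_system_cong)
qed

lemma column51_system_11: "column_system 2 10 {0..<51} column51 (colour51 11)"
proof -
  let ?L = "map (apsnd (bin 10)) code51"
  have len: "length code51 = 51" by code_simp
  then have eq: "length ?L = 51" "1 + 1 = (2 :: nat)" "5 + 5 = (10 :: nat)" by simp_all
  have "column_system (1 + 1) (5 + 5) {0..<length ?L} (\<lambda>i. pol (snd (?L ! i))) (\<lambda>i. fst (?L ! i))"
  proof (rule column_system_list)
    show "list_all (\<lambda>(a, x). length x = 5 + 5 \<and> True \<in> set x) ?L" by code_simp
    show "distinct (map snd ?L)" by code_simp
    show "sumset_full 5 5 [(csums (bin (5 + 5) 0) 1 ?L, csums (bin (5 + 5) 0) 1 ?L)]"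
      by code_simp
  qed
  then have "column_system 2 10 {0..<51} (\<lambda>i. pol (snd (?L ! i))) (\<lambda>i. fst (?L ! i))"
    unfolding eq .
  moreover have "pol (snd (?L ! i)) = column51 i" "fst (?L ! i) = colour51 11 i" if "i \<in> {0..<51}" for i
    using that len by (simp_all add: column51_def colour51_def)
  ultimately show ?thesis by (rule column_system_cong)
qed

lemma colour51_less: "i < 51 \<Longrightarrow> fst (code51 ! i) < 11"
proof -
  have "list_all (\<lambda>p. fst p < 11) code51" "length code51 = 51" by code_simp+
  then show "i < 51 \<Longrightarrow> fst (code51 ! i) < 11" by (simp add: list_all_length)
qed

text \<open>The added colours are at least 11 and occur once each, while the original ones are below
  11.\<close>

lemma colour51_refines:
  assumes "i \<in> {0..<51}" "j \<in> {0..<51}" "colour51 k i = colour51 k j"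
  shows "colour51 11 i = colour51 11 j"
  using assms colour51_less[of i] colour51_less[of j]
  by (auto simp: colour51_def split: if_splits)

lemma column51_system: "column_system 2 10 {0..<51} column51 (colour51 k)"
  by (rule column_system_refine[OF column51_system_11 colour51_refines])

lemma colour51_image:
  assumes k: "11 \<le> k" "k \<le> 32"
  shows "colour51 k ` {0..<51} = {0..<k}"
proof
  show "colour51 k ` {0..<51} \<subseteq> {0..<k}"
    using k colour51_less by (force simp: colour51_def)
  show "{0..<k} \<subseteq> colour51 k ` {0..<51}"
  proof
    fix a assume a: "a \<in> {0..<k}"
    show "a \<in> colour51 k ` {0..<51}"
    proof (cases "a < 11")
      case True
      \<comment> \<open>As \<open>k - 11\<close> is at most 21, the columns from index 21 on keep
        their original colours.\<close>
      have "list_all (\<lambda>a. list_ex (\<lambda>i. fst (code51 ! i) = a) [21..<51]) [0..<11]" by code_simp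
      then have "\<forall>a\<in>{0..<11}. \<exists>i\<in>{21..<51}. fst (code51 ! i) = a"
        unfolding list_all_iff list_ex_iff set_upt .
      with True obtain i where "21 \<le> i" "i < 51" "fst (code51 ! i) = a"
        by (meson atLeastLessThan_iff zero_le)
      with k show ?thesis by (intro image_eqI[of _ _ i]) (auto simp: colour51_def)
    next
      case False
      with a k show ?thesis by (intro image_eqI[of _ _ "a - 11"]) (auto simp: colour51_def)
    qed
  qed
qed

lemma sum_column51:
  "(\<Sum>i\<leftarrow>js. column51 i) = pol (foldr (\<lambda>i. ladd (bin 10 (snd (code51 ! i)))) js [])"
  by (induction js) (simp_all add: column51_def pol_ladd)

text \<open>The columns 13, 946 and 959, of colours 2, 8 and 10, add up to zero.\<close>

lemma column51_triangle: "cover 3 3 {0..<51} column51 (colour51 k) 0"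
proof (rule cover_refine[OF _ colour51_refines])
  have "True \<notin> set (foldr (\<lambda>i. ladd (bin 10 (snd (code51 ! i)))) [1, 48, 50] [])" by code_simp
  then have "(\<Sum>i\<leftarrow>[1, 48, 50]. column51 i) = 0"
    unfolding sum_column51 pol_eq_0 .
  moreover have "distinct (map (colour51 11) [1, 48, 50])" by code_simp
  ultimately show "cover 3 3 {0..<51} column51 (colour51 11) 0"
    by (intro coverI[of "[1, 48, 50]"]) simp_all
qed

text \<open>Quadruples of columns with sum 0 that together contain every column.\<close>

definition relations51 :: "nat list list" where
  "relations51 = [
     [8, 10, 27, 11], [5, 4, 17, 19], [32, 34, 40, 48], [45, 42, 47, 44], [12, 14, 21, 24],
     [0, 26, 29, 31], [3, 36, 37, 28], [20, 15, 22, 23], [6, 16, 43, 18], [25, 41, 30, 49],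
     [38, 39, 46, 50], [9, 1, 2, 11], [13, 7, 28, 50], [33, 35, 40, 39]]"

text \<open>Removing a column from a quadruple with sum zero leaves three columns that add up to
  it.\<close>

lemma column51_dependent:
  assumes "i \<in> {0..<51}"
  shows "cover 2 3 {0..<51} column51 id (column51 i)"
proof -
  have "list_all (\<lambda>i. list_ex (\<lambda>js. i \<in> set js) relations51) [0..<51]" by code_simp
  with assms obtain js where js: "js \<in> set relations51" "i \<in> set js"
    unfolding list_all_iff list_ex_iff set_upt by blast
  have "list_all (\<lambda>js. length js = 4 \<and> distinct js \<and> list_all (\<lambda>i. i < 51) js \<and>
      True \<notin> set (foldr (\<lambda>i. ladd (bin 10 (snd (code51 ! i)))) js [])) relations51"
    by code_simp
  with js(1) have *: "length js = 4" "distinct js" "set js \<subseteq> {0..<51}" "(\<Sum>i\<leftarrow>js. column51 i) = 0"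
    unfolding sum_column51 pol_eq_0 by (auto simp: list_all_iff)
  have "(\<Sum>j\<leftarrow>js. column51 j) = column51 i + (\<Sum>j\<leftarrow>remove1 i js. column51 j)"
    using js(2) by (rule sum_list_map_remove1)
  with *(4) have "(\<Sum>j\<leftarrow>remove1 i js. column51 j) = column51 i"
    by (simp add: bit_poly_add_eq_0_iff)
  moreover have "set (remove1 i js) \<subseteq> {0..<51}" using *(3) set_remove1_subset by fastforce
  ultimately show ?thesis
    using * js(2) by (intro coverI[of "remove1 i js"]) (simp_all add: length_remove1)
qed

text \<open>Both 16 and 32 lie between 11 and 32, so the 51 columns can be coloured by exactly the
  residues modulo \<open>f\<close>. As \<open>10 + 2 * m = 2 * (m + 5)\<close>, the result fits an
  outer modulus of degree 9 or 10.\<close>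

lemma lifted_system:
  assumes f: "degree f = m" "4 \<le> m" "m \<le> 5"
    and unit: "\<And>g. g \<in> vecs m \<Longrightarrow> g \<noteq> 0 \<Longrightarrow> unit_mod f g"
  obtains I :: "(nat \<times> bit poly + bit poly) set" and s \<kappa>
  where "column_system 2 (10 + 2 * m) I s (\<kappa> :: _ \<Rightarrow> bit poly \<times> bool + unit)" "cover 3 3 I s \<kappa> 0"
    "card I = 51 * 2 ^ m + (2 ^ m - 1)" "card (\<kappa> ` I) \<le> 2 * 2 ^ m + 1"
proof -
  interpret concatenation f m 10 using f by unfold_locales auto
  \<comment> \<open>The bijection \<theta> names the colours by residues, so that each colour is its
    own multiplier.\<close>
  have "card {0..<(2 :: nat) ^ m} = card (vecs m)" by (simp add: card_vecs)
  then obtain \<theta> where \<theta>: "bij_betw \<theta> {0..<(2 :: nat) ^ m} (vecs m)"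
    using finite_same_card_bij[of "{0..<(2 :: nat) ^ m}" "vecs m"] by auto
  have "m = 4 \<or> m = 5" using f by linarith
  then have "11 \<le> (2 :: nat) ^ m" "(2 :: nat) ^ m \<le> 32" by auto
  note image = colour51_image[OF this]
  define \<mu> where "\<mu> = \<theta> \<circ> colour51 (2 ^ m)"
  have \<mu>: "\<mu> ` {0..<51} = vecs m"
    using \<theta> unfolding \<mu>_def image_comp[symmetric] image by (simp add: bij_betw_def)
  have refine: "colour51 (2 ^ m) i = colour51 (2 ^ m) j"
    if "i \<in> {0..<51}" "j \<in> {0..<51}" "\<mu> i = \<mu> j" for i j
  proof (rule inj_onD)
    show "inj_on \<theta> {0..<2 ^ m}" using \<theta> by (simp add: bij_betw_def)
  qed (use that image in \<open>auto simp: \<mu>_def\<close>)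
  note sys = column_system_refine[where \<mu> = \<mu>, OF column51_system refine]
    and tri = cover_refine[where \<mu> = \<mu>, OF column51_triangle refine]
  show thesis
    by (rule that[OF lift2_system[OF sys \<mu> unit] lift2_triangle[OF tri]])
      (use card_lift2(1)[of "{0..<51 :: nat}"] card_lift2(2)[of "{0..<51 :: nat}" \<mu>] \<mu> in \<open>simp_all add: card_vecs\<close>)
qed

text \<open>The number 24 counts one class for each of the 23 Golay columns and one for the columns
  that correct the last block.\<close>

lemma golay_concatenation:
  assumes f: "degree f = m" "5 \<le> m"
    and unit: "\<And>g. g \<in> vecs 5 \<Longrightarrow> g \<noteq> 0 \<Longrightarrow> unit_mod f g"
    and I: "column_system 2 (2 * m) I s \<kappa>" "cover 3 3 I s \<kappa> 0"
    and n: "23 * 2 ^ m + (2 ^ m - 1) + card I = n" "(n + 1)\<^sup>2 < 2 ^ (11 + 3 * m)"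
    and p: "24 + card (\<kappa> ` I) \<le> p"
  shows "\<exists>H. is_matrix (11 + 3 * m) n H \<and> min_dist H n 3 \<and> covering_radius H (11 + 3 * m) n 3 \<and>
    (\<exists>P. RL_partition H (11 + 3 * m) n 3 0 P \<and> card P \<le> p) \<and>
    (\<exists>P. RL_partition H (11 + 3 * m) n 3 1 P \<and> card P \<le> p) \<and>
    ((\<forall>i\<in>I. cover 2 3 I s id (s i)) \<longrightarrow> (\<exists>P. RL_partition H (11 + 3 * m) n 3 2 P))"
proof -
  interpret concatenation f m 11 using f by unfold_locales auto
  \<comment> \<open>There are 31 nonzero polynomials of degree below 5, enough for 23 distinct
    multipliers.\<close>
  have "card {0..<23 :: nat} \<le> card (vecs 5 - {0})" by (simp add: card_vecs)
  then obtain \<beta> where \<beta>: "\<beta> ` {0..<23 :: nat} \<subseteq> vecs 5 - {0}" "inj_on \<beta> {0..<23}"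
    using card_le_inj[of "{0..<23 :: nat}" "vecs 5 - {0}"] by auto
  have u1: "unit_mod f (\<beta> j)" if "j \<in> {0..<23}" for j
    using \<beta>(1) that by (intro unit) (auto simp: image_subset_iff)
  have u2: "unit_mod f (\<beta> i + \<beta> j)" if "i \<in> {0..<23}" "j \<in> {0..<23}" "i \<noteq> j" for i j
    using \<beta> that by (intro unit) (auto simp: bit_poly_add_eq_0_iff image_subset_iff dest: inj_onD)
  have fin: "finite I" using I(1) by (simp add: column_system_def)
  have dep: "(\<forall>i\<in>I. cover 2 3 I s id (s i)) \<longrightarrow> (\<forall>k\<in>lift3_index {0..<23} I.
      cover 2 3 (lift3_index {0..<23} I) (lift3_column golay \<beta> s) id (lift3_column golay \<beta> s k))"
    using f by (intro impI ballI lift3_column_dependent) auto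
  have card: "card (lift3_index {0..<23 :: nat} I) = n"
    using card_lift3(1)[OF fin, of "{0..<23 :: nat}"] n by simp
  have colours: "card (lift3_colour \<kappa> ` lift3_index {0..<23 :: nat} I) \<le> p"
    using card_lift3(2)[OF fin, of "{0..<23 :: nat}" \<kappa>] p by simp
  show ?thesis
    by (rule realization[OF lift3_system[OF golay_system u1 u2 I(1)] lift3_triangle[OF I(2)]
          card n(2) colours]) (use dep in blast)+
qed

theorem theorem7p5:
  shows "((\<exists>H. code_params H 818 26 3 3 2 \<and>
            (\<exists>P. RL_partition H 26 818 3 0 P \<and> card P \<le> 35) \<and>
            (\<exists>P. RL_partition H 26 818 3 1 P \<and> card P \<le> 35) \<and>
            (\<exists>P. RL_partition H 26 818 3 2 P)) \<and> ell2 26 3 \<le> 818) \<and>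
        ((\<exists>H. code_params H 13118 38 3 3 1 \<and>
            (\<exists>P. RL_partition H 38 13118 3 0 P \<and> card P \<le> 57) \<and>
            (\<exists>P. RL_partition H 38 13118 3 1 P \<and> card P \<le> 59)) \<and> ell2 38 3 \<le> 13118) \<and>
        ((\<exists>H. code_params H 26238 41 3 3 1 \<and>
            (\<exists>P. RL_partition H 41 26238 3 0 P \<and> card P \<le> 89) \<and>
            (\<exists>P. RL_partition H 41 26238 3 1 P \<and> card P \<le> 91)) \<and> ell2 41 3 \<le> 26238)"
proof (intro conjI)
  \<comment> \<open>With \<open>m = 5\<close>: length 23 * 32 + 31 + 51 = 818 and 24 + 11 = 35
    classes.\<close>
  have "card (colour51 11 ` {0..<51}) = 11" by (simp add: colour51_image)
  then obtain H where "is_matrix 26 818 H" "min_dist H 818 3" "covering_radius H 26 818 3"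
    "\<exists>P. RL_partition H 26 818 3 0 P \<and> card P \<le> 35" "\<exists>P. RL_partition H 26 818 3 1 P \<and> card P \<le> 35"
    "\<exists>P. RL_partition H 26 818 3 2 P"
    using golay_concatenation[OF degree_moduli(2) _ unit_mod_5, of "{0..<51}" column51 "colour51 11" 818 35]
      column51_system[of 11] column51_triangle[of 11] column51_dependent by auto
  then show "\<exists>H. code_params H 818 26 3 3 2 \<and>
            (\<exists>P. RL_partition H 26 818 3 0 P \<and> card P \<le> 35) \<and>
            (\<exists>P. RL_partition H 26 818 3 1 P \<and> card P \<le> 35) \<and>
            (\<exists>P. RL_partition H 26 818 3 2 P)" "ell2 26 3 \<le> 818"
    using ell2_le unfolding code_params_def by blast+
next
  \<comment> \<open>With outer \<open>m = 9\<close>: length 23 * 512 + 511 + 831 = 13118 and 24 + 33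
    = 57 classes.\<close>
  obtain I :: "(nat \<times> bit poly + bit poly) set" and s and \<kappa> :: "_ \<Rightarrow> bit poly \<times> bool + unit"
    where I: "column_system 2 18 I s \<kappa>" "cover 3 3 I s \<kappa> 0" "card I = 831" "card (\<kappa> ` I) \<le> 33"
    using lifted_system[OF degree_moduli(1) _ _ unit_mod_4] by auto
  then obtain H where "is_matrix 38 13118 H" "min_dist H 13118 3" "covering_radius H 38 13118 3"
    "\<exists>P. RL_partition H 38 13118 3 0 P \<and> card P \<le> 57" "\<exists>P. RL_partition H 38 13118 3 1 P \<and> card P \<le> 57"
    using golay_concatenation[OF degree_moduli(3) _ unit_mod_9, of I s \<kappa> 13118 57] by auto
  \<comment> \<open>The bound 57 also holds for the (3,1)-partition and implies 59.\<close>
  moreover from this(5) have "\<exists>P. RL_partition H 38 13118 3 1 P \<and> card P \<le> 59"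
    by (auto intro: order_trans)
  ultimately show "\<exists>H. code_params H 13118 38 3 3 1 \<and>
            (\<exists>P. RL_partition H 38 13118 3 0 P \<and> card P \<le> 57) \<and>
            (\<exists>P. RL_partition H 38 13118 3 1 P \<and> card P \<le> 59)" "ell2 38 3 \<le> 13118"
    using ell2_le unfolding code_params_def by blast+
next
  \<comment> \<open>With outer \<open>m = 10\<close>: length 23 * 1024 + 1023 + 1663 = 26238 and 24
    + 65 = 89 classes.\<close>
  obtain I :: "(nat \<times> bit poly + bit poly) set" and s and \<kappa> :: "_ \<Rightarrow> bit poly \<times> bool + unit"
    where I: "column_system 2 20 I s \<kappa>" "cover 3 3 I s \<kappa> 0" "card I = 1663" "card (\<kappa> ` I) \<le> 65"
    using lifted_system[OF degree_moduli(2) _ _ unit_mod_5] by auto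
  then obtain H where "is_matrix 41 26238 H" "min_dist H 26238 3" "covering_radius H 41 26238 3"
    "\<exists>P. RL_partition H 41 26238 3 0 P \<and> card P \<le> 89" "\<exists>P. RL_partition H 41 26238 3 1 P \<and> card P \<le> 89"
    using golay_concatenation[OF degree_moduli(4) _ unit_mod_10, of I s \<kappa> 26238 89] by auto
  moreover from this(5) have "\<exists>P. RL_partition H 41 26238 3 1 P \<and> card P \<le> 91"
    by (auto intro: order_trans)
  ultimately show "\<exists>H. code_params H 26238 41 3 3 1 \<and>
            (\<exists>P. RL_partition H 41 26238 3 0 P \<and> card P \<le> 89) \<and>
            (\<exists>P. RL_partition H 41 26238 3 1 P \<and> card P \<le> 91)" "ell2 41 3 \<le> 26238"
    using ell2_le unfolding code_params_def by blast+
qed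

end
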